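(* Let $p\ge5$ be a prime, let $k$ be even with $k<p$, and let $b$ be real with $b-\frac1{p-1}>0$. Then \[\mathcal{M}^{(k)}_a(b)=V_k(b)\oplus\partial_a\widetilde{\mathcal{M}}^{(k)}_a(b)\oplus\mathcal{I}_{ker}(b).\]
   Context: $\mathrm{ord}$ is the $p$-adic valuation on $\mathbb{C}_p$ with $\mathrm{ord}(p)=1$, and $\pi\in\mathbb{C}_p$ with $\pi^{p-1}=-p$. For $\rho\in\mathbb{R}$ let $L(b;\rho):=\{\sum_{i\ge0}B_ia^i:B_i\in\mathbb{C}_p,\ \mathrm{ord}(B_i)\ge\frac{2b}{3}i+\rho\ \forall i\}$, $L(b):=\bigcup_\rho L(b;\rho)$, $\delta_m:=bm/3$. Elements are row vectors $\xi=(\xi_1,\ldots,\xi_{k+1})$ of power series in $a$ (coordinates with respect to $v^k,v^{k-1}w,\ldots,w^k$, $v=x$, $w=x^2$). $\mathcal{M}^{(k)}_a(b;\rho):=\{\xi:\xi_m\in L(b;\delta_m+\rho),\ m=1,\ldots,k+1\}$, $\mathcal{M}^{(k)}_a(b):=\bigcup_\rho\mathcal{M}^{(k)}_a(b;\rho)$, and $\widetilde{\mathcal{M}}^{(k)}_a(b):=\{\xi\in\mathcal{M}^{(k)}_a(b):\xi_{k+1}=0\}$. $V_k$ is the $\mathbb{C}_p$-span of the constant row vectors together with $a\,e_{2j+1}$ for $j=0,1,\ldots,k/2-1$ ($e_m$ the $m$-th standard basis row vector), and $V_k(b):=V_k\cap\mathcal{M}^{(k)}_a(b)$. $G_k$ is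 the $(k+1)\times(k+1)$ matrix with $(G_k)_{i,i+1}=(k-i+1)\pi a$, $(G_k)_{i+1,i}=-\frac{i\pi a^2}{3}$ for $1\le i\le k$, other entries $0$; $\partial_a\xi:=a\frac{d\xi}{da}-\xi G_k$. Let $\mathbf{k}:=(K_1,0,K_3,0,\ldots,0,K_{k+1})$ with $K_{2j+1}:=\frac{\prod_{i=1}^j[\frac k2-(i-1)]}{j!\,3^{k/2-j}}a^{k/2-j}$ for $j=0,\ldots,k/2$ (so $\mathbf{k}G_k=0$), and $\mathcal{I}_{ker}(b):=\{a\,h\,\mathbf{k}:h\in L(b)\}$. *)

theory Defs
  imports
    "HOL-Computational_Algebra.Computational_Algebra"
    "HOL-Library.Extended_Real"
    "HOL-Library.Function_Algebras"
    "HOL-Library.Set_Algebras"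
begin

text \<open>
  The field of \<open>p\<close>-adic complex numbers is described by the properties that determine the pair
  (field, valuation) up to isomorphism: it is an algebraically closed field (a sort constraint),
  complete for a valuation \<open>ord\<close> with \<open>ord p = 1\<close>, in which the elements algebraic
  over the topological closure of the rationals are dense. By completeness this closure is the
  field of \<open>p\<close>-adic numbers, so its relative algebraic closure is an algebraic closure, and the
  whole field is the completion of the latter.
\<close>

locale padic_valued_field =
  fixes p :: nat
    and ord :: "'a::field_char_0 \<Rightarrow> ereal"
  assumes prime_p: "prime p"
    and ord_eq_infinity_iff: "ord x = \<infinity> \<longleftrightarrow> x = 0"
    and ord_neq_minus_infinity: "ord x \<noteq> -\<infinity>"
    and ord_mult: "ord (x * y) = ord x + ord y"
    and ord_add: "min (ord x) (ord y) \<le> ord (x + y)"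
    and ord_p: "ord (of_nat p) = 1"
begin

definition ord_Cauchy :: "(nat \<Rightarrow> 'a) \<Rightarrow> bool" where
  "ord_Cauchy X \<longleftrightarrow>
     (\<forall>M::real. \<exists>N. \<forall>m\<ge>N. \<forall>n\<ge>N. ord (X m - X n) \<ge> ereal M)"

definition ord_converges :: "(nat \<Rightarrow> 'a) \<Rightarrow> 'a \<Rightarrow> bool" where
  "ord_converges X x \<longleftrightarrow> (\<forall>M::real. \<exists>N. \<forall>n\<ge>N. ord (X n - x) \<ge> ereal M)"

definition ord_closure :: "'a set \<Rightarrow> 'a set" where
  "ord_closure S = {x. \<forall>M::real. \<exists>y\<in>S. ord (x - y) \<ge> ereal M}"

definition padic_numbers :: "'a set" where
  "padic_numbers = ord_closure \<rat>"

definition algebraic_over_padics :: "'a set" where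
  "algebraic_over_padics =
     {x. \<exists>P. P \<noteq> 0 \<and> (\<forall>i. coeff P i \<in> padic_numbers) \<and> poly P x = 0}"

end

locale padic_complex_field = padic_valued_field p ord
  for p :: nat and ord :: "'a::{field_char_0, alg_closed_field} \<Rightarrow> ereal" +
  assumes complete: "ord_Cauchy X \<Longrightarrow> \<exists>x. ord_converges X x"
    and algebraic_dense: "ord_closure algebraic_over_padics = UNIV"

text \<open>
  A row vector of length \<open>k + 1\<close> of power series in \<open>a\<close> (the variable \<^term>\<open>fps_X\<close>) is a
  function with index set \<open>{1..k+1}\<close>, extended by zero to all natural numbers.
\<close>

definition row_vectors :: "nat \<Rightarrow> (nat \<Rightarrow> 'a::field fps) set" where
  "row_vectors k = {\<xi>. \<forall>m. m \<notin> {1..k+1} \<longrightarrow> \<xi> m = 0}"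

definition scale_row :: "'a::field \<Rightarrow> (nat \<Rightarrow> 'a fps) \<Rightarrow> (nat \<Rightarrow> 'a fps)" where
  "scale_row c \<xi> = (\<lambda>m. fps_const c * \<xi> m)"

global_interpretation row: vector_space scale_row
  by standard
    (simp_all add: scale_row_def fun_eq_iff algebra_simps
      flip: fps_const_add fps_const_mult)

definition is_direct_sum3 ::
    "(nat \<Rightarrow> 'a::field fps) set \<Rightarrow> (nat \<Rightarrow> 'a fps) set \<Rightarrow> (nat \<Rightarrow> 'a fps) set
      \<Rightarrow> (nat \<Rightarrow> 'a fps) set \<Rightarrow> bool" where
  "is_direct_sum3 M A B C \<longleftrightarrow>
     row.subspace M \<and> row.subspace A \<and> row.subspace B \<and> row.subspace C \<and>
     M = A + B + C \<and>
     (\<forall>x\<in>A. \<forall>y\<in>B. \<forall>z\<in>C. x + y + z = 0 \<longrightarrow> x = 0 \<and> y = 0 \<and> z = 0)"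

definition L_rho :: "('a::field \<Rightarrow> ereal) \<Rightarrow> real \<Rightarrow> real \<Rightarrow> 'a fps set" where
  "L_rho ord b \<rho> = {f. \<forall>i. ord (fps_nth f i) \<ge> ereal (2 * b / 3 * real i + \<rho>)}"

definition L :: "('a::field \<Rightarrow> ereal) \<Rightarrow> real \<Rightarrow> 'a fps set" where
  "L ord b = (\<Union>\<rho>. L_rho ord b \<rho>)"

definition \<delta> :: "real \<Rightarrow> nat \<Rightarrow> real" where
  "\<delta> b m = b * real m / 3"

definition M_rho :: "('a::field \<Rightarrow> ereal) \<Rightarrow> nat \<Rightarrow> real \<Rightarrow> real \<Rightarrow> (nat \<Rightarrow> 'a fps) set" where
  "M_rho ord k b \<rho> = {\<xi> \<in> row_vectors k. \<forall>m\<in>{1..k+1}. \<xi> m \<in> L_rho ord b (\<delta> b m + \<rho>)}"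

definition M_sp :: "('a::field \<Rightarrow> ereal) \<Rightarrow> nat \<Rightarrow> real \<Rightarrow> (nat \<Rightarrow> 'a fps) set" where
  "M_sp ord k b = (\<Union>\<rho>. M_rho ord k b \<rho>)"

definition M_tilde :: "('a::field \<Rightarrow> ereal) \<Rightarrow> nat \<Rightarrow> real \<Rightarrow> (nat \<Rightarrow> 'a fps) set" where
  "M_tilde ord k b = {\<xi> \<in> M_sp ord k b. \<xi> (k+1) = 0}"

definition unit_row :: "nat \<Rightarrow> nat \<Rightarrow> 'a::field fps" where
  "unit_row m = (\<lambda>i. if i = m then 1 else 0)"

definition constant_rows :: "nat \<Rightarrow> (nat \<Rightarrow> 'a::field fps) set" where
  "constant_rows k = {\<xi> \<in> row_vectors k. \<forall>m. \<exists>c. \<xi> m = fps_const c}"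

definition V_span :: "nat \<Rightarrow> (nat \<Rightarrow> 'a::field fps) set" where
  "V_span k = row.span
     (constant_rows k \<union> {(\<lambda>m. fps_X * unit_row (2*j+1) m) |j. j < k div 2})"

definition V_sp :: "('a::field \<Rightarrow> ereal) \<Rightarrow> nat \<Rightarrow> real \<Rightarrow> (nat \<Rightarrow> 'a fps) set" where
  "V_sp ord k b = V_span k \<inter> M_sp ord k b"

definition G_mat :: "nat \<Rightarrow> 'a::field \<Rightarrow> nat \<Rightarrow> nat \<Rightarrow> 'a fps" where
  "G_mat k \<pi> r s =
     (if 1 \<le> r \<and> r \<le> k \<and> s = r + 1 then fps_const (of_nat (k - r + 1) * \<pi>) * fps_X
      else if 1 \<le> s \<and> s \<le> k \<and> r = s + 1 then - (fps_const (of_nat s * \<pi> / 3) * fps_X ^ 2)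
      else 0)"

definition row_times_mat ::
    "nat \<Rightarrow> (nat \<Rightarrow> 'a::field fps) \<Rightarrow> (nat \<Rightarrow> nat \<Rightarrow> 'a fps) \<Rightarrow> nat \<Rightarrow> 'a fps" where
  "row_times_mat k \<xi> A = (\<lambda>m. \<Sum>i=1..k+1. \<xi> i * A i m)"

definition partial_a :: "nat \<Rightarrow> 'a::field \<Rightarrow> (nat \<Rightarrow> 'a fps) \<Rightarrow> nat \<Rightarrow> 'a fps" where
  "partial_a k \<pi> \<xi> = (\<lambda>m. fps_X * fps_deriv (\<xi> m)) - row_times_mat k \<xi> (G_mat k \<pi>)"

text \<open>
  For \<open>k\<close> even; the entry at the odd index \<open>m = 2 j + 1\<close> has \<open>j = m div 2\<close>.
\<close>

definition K_coeff :: "nat \<Rightarrow> nat \<Rightarrow> 'a::field_char_0" where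
  "K_coeff k j =
     (\<Prod>i=1..j. of_nat (k div 2) - (of_nat i - 1)) / (fact j * 3 ^ (k div 2 - j))"

definition ker_row :: "nat \<Rightarrow> nat \<Rightarrow> 'a::field_char_0 fps" where
  "ker_row k m =
     (if m \<in> {1..k+1} \<and> odd m
      then fps_const (K_coeff k (m div 2)) * fps_X ^ (k div 2 - m div 2) else 0)"

definition I_ker :: "('a::field_char_0 \<Rightarrow> ereal) \<Rightarrow> nat \<Rightarrow> real \<Rightarrow> (nat \<Rightarrow> 'a fps) set" where
  "I_ker ord k b = {(\<lambda>m. fps_X * h * ker_row k m) |h. h \<in> L ord b}"

end

(*
  Give a weight 2 and the m-th coordinate weight m. Multiplication by G raises the weight by 3,
  which is worth b, at the price of one factor pi; so solving for eta in
  xi = v + eta G + a h k gains epsilon = b - 1/(p-1) > 0 in the growth condition. This algebraic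
  decomposition exists and is unique: h is read off by pairing with the column kernel
  of G (the pairing of the two kernel vectors is a unit because k < p), and then eta is found by
  recursion, upwards through its even and downwards through its odd entries. Replacing eta G by
  partial eta is a perturbation that a contraction argument absorbs: write
  theta = a d/da and let N xi be the eta of xi; then eta = N(xi + theta eta) has a solution by
  completeness, and a relation v + partial eta + a h k = 0 improves the growth of eta by epsilon
  indefinitely, forcing eta = 0.
*)

theory Submission
  imports Defs
begin

section \<open>Arithmetic of the valuation\<close>

context padic_valued_field
begin

lemma ord_0 [simp]: "ord 0 = \<infinity>"
  by (simp add: ord_eq_infinity_iff)

lemma ord_1 [simp]: "ord 1 = 0"
proof -
  have "ord 1 = ord 1 + ord 1" using ord_mult[of 1 1] by simp
  moreover have "ord 1 \<noteq> \<infinity>" by (simp add: ord_eq_infinity_iff)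
  ultimately show ?thesis using ord_neq_minus_infinity[of 1] by (cases "ord 1") auto
qed

lemma ord_real: "x \<noteq> 0 \<Longrightarrow> \<exists>r. ord x = ereal r"
  using ord_neq_minus_infinity[of x] by (cases "ord x") (auto simp: ord_eq_infinity_iff)

lemma ord_uminus [simp]: "ord (- x) = ord x"
proof -
  have "ord (-1) + ord (-1) = 0" using ord_mult[of "-1" "-1"] by simp
  then have "ord (-1) = 0" by (cases "ord (-1)") auto
  then show ?thesis using ord_mult[of "-1" x] by simp
qed

lemma ord_ge_add: "c \<le> ord x \<Longrightarrow> c \<le> ord y \<Longrightarrow> c \<le> ord (x + y)"
  using ord_add[of x y] by (meson min.boundedI order_trans)

lemma ord_ge_diff: "c \<le> ord x \<Longrightarrow> c \<le> ord y \<Longrightarrow> c \<le> ord (x - y)"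
  using ord_ge_add[of c x "- y"] by simp

lemma ord_ge_sum: "(\<And>i. i \<in> A \<Longrightarrow> c \<le> ord (f i)) \<Longrightarrow> c \<le> ord (sum f A)"
  by (induction A rule: infinite_finite_induct) (auto intro: ord_ge_add)

lemma ord_ge_mult:
  "ereal r \<le> ord x \<Longrightarrow> ereal s \<le> ord y \<Longrightarrow> t \<le> r + s \<Longrightarrow> ereal t \<le> ord (x * y)"
  using add_mono[of "ereal r" "ord x" "ereal s" "ord y"] ord_mult[of x y]
  by (metis ereal_less_eq(3) order_trans plus_ereal.simps(1))

lemma ord_of_nat_nonneg: "0 \<le> ord (of_nat m)"
  by (induction m) (auto intro: ord_ge_add)

text \<open>By Bezout \<open>u m + v p = 1\<close>. If \<open>m\<close> had positive order, both
  summands would, contradicting \<open>ord 1 = 0\<close>.\<close>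

lemma ord_of_nat_unit:
  assumes "0 < m" "m < p" shows "ord (of_nat m) = 0"
proof -
  have "coprime (int m) (int p)"
    using assms prime_imp_coprime[OF prime_p, of m] by (simp add: coprime_commute nat_dvd_not_less)
  then obtain u v :: int where uv: "u * int m + v * int p = 1"
    by (metis bezout_int coprime_iff_gcd_eq_1)
  have nonneg: "0 \<le> ord (of_int z)" for z :: int
    by (cases z rule: int_cases2) (auto simp: ord_of_nat_nonneg)
  have eq: "of_int u * of_nat m + of_int v * of_nat p = (1 :: 'a)"
    using arg_cong[OF uv, of "of_int :: int \<Rightarrow> 'a"] by simp
  show ?thesis
  proof (rule ccontr)
    assume "ord (of_nat m) \<noteq> 0"
    then have pos: "0 < ord (of_nat m)" using ord_of_nat_nonneg[of m] by auto
    have "0 < ord (of_int u * of_nat m)"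
      using add_nonneg_pos[OF nonneg[of u] pos] by (simp add: ord_mult)
    moreover have "0 < ord (of_int v * of_nat p)"
      using add_nonneg_pos[OF nonneg[of v], of "ord (of_nat p)"] by (simp add: ord_mult ord_p)
    ultimately have "0 < ord (1 :: 'a)"
      using ord_add[of "of_int u * of_nat m" "of_int v * of_nat p"] eq
      by (metis min_less_iff_conj order_less_le_trans)
    then show False by simp
  qed
qed

lemma ord_divide_unit: "ord y = 0 \<Longrightarrow> ord (x / y) = ord x"
  using ord_mult[of "x / y" y] by (cases "y = 0") auto

lemma ord_mult_unit: "ord x = 0 \<Longrightarrow> ord y = 0 \<Longrightarrow> ord (x * y) = 0"
  by (simp add: ord_mult)

lemma ord_power_unit: "ord x = 0 \<Longrightarrow> ord (x ^ m) = 0"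
  by (induction m) (auto simp: ord_mult)

lemma ord_prod_unit: "(\<And>i. i \<in> A \<Longrightarrow> ord (f i) = 0) \<Longrightarrow> ord (prod f A) = 0"
  by (induction A rule: infinite_finite_induct) (auto simp: ord_mult)

text \<open>A nonzero element has finite order. The bound climbs in steps of \<open>e\<close>
  because the comparisons below gain a fixed \<epsilon> per round.\<close>

lemma eq_0_if_ord_unbounded:
  assumes "\<And>n::nat. ereal (r + real n * e) \<le> ord x" "0 < e" shows "x = 0"
proof (rule ccontr)
  assume "x \<noteq> 0"
  then obtain s where s: "ord x = ereal s" using ord_real by blast
  obtain n :: nat where "s - r < real n * e" using reals_Archimedean3[OF assms(2)] by blast
  then show False using assms(1)[of n] s by auto
qed

end

section \<open>Row vectors, the action of G, and the space V_k\<close>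

lemma row_vectors_0: "\<xi> \<in> row_vectors k \<Longrightarrow> m = 0 \<or> k + 1 < m \<Longrightarrow> \<xi> m = 0"
  by (auto simp: row_vectors_def)

lemma row_vectors_add: "\<xi> \<in> row_vectors k \<Longrightarrow> \<eta> \<in> row_vectors k \<Longrightarrow> \<xi> + \<eta> \<in> row_vectors k"
  by (auto simp: row_vectors_def)

lemma row_vectors_diff: "\<xi> \<in> row_vectors k \<Longrightarrow> \<eta> \<in> row_vectors k \<Longrightarrow> \<xi> - \<eta> \<in> row_vectors k"
  by (auto simp: row_vectors_def)

text \<open>G has only its two off-diagonals, so entry \<open>m\<close> sees just its neighbours. At
  both ends the missing neighbour is an entry of the zero extension, which spares a case
  distinction.\<close>

lemma row_times_G_mat:
  assumes "\<xi> \<in> row_vectors k"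
  shows "row_times_mat k \<xi> (G_mat k \<pi>) m =
    (if m \<in> {1..k+1} then fps_const (of_nat (k + 2 - m) * \<pi>) * fps_X * \<xi> (m - 1)
       - fps_const (of_nat m * \<pi> / 3) * fps_X ^ 2 * \<xi> (m + 1) else 0)"
proof (cases "m \<in> {1..k+1}")
  case False
  then have "G_mat k \<pi> i m = 0" for i by (auto simp: G_mat_def)
  then show ?thesis unfolding if_not_P[OF False] by (simp add: row_times_mat_def)
next
  case True
  have "row_times_mat k \<xi> (G_mat k \<pi>) m =
      (\<Sum>i=1..k+1. (if i = m - 1 then fps_const (of_nat (k + 2 - m) * \<pi>) * fps_X * \<xi> i else 0) +
         (if i = m + 1 then - (fps_const (of_nat m * \<pi> / 3) * fps_X ^ 2 * \<xi> i) else 0))"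
    unfolding row_times_mat_def using True
    by (intro sum.cong) (auto simp: G_mat_def Suc_diff_le)
  also have "\<dots> = fps_const (of_nat (k + 2 - m) * \<pi>) * fps_X * \<xi> (m - 1)
       - fps_const (of_nat m * \<pi> / 3) * fps_X ^ 2 * \<xi> (m + 1)"
    using True row_vectors_0[OF assms] by (auto simp: sum.distrib sum.delta)
  finally show ?thesis using True by simp
qed

lemma row_times_mat_add: "row_times_mat k (\<xi> + \<eta>) A = row_times_mat k \<xi> A + row_times_mat k \<eta> A"
  by (rule ext) (simp add: row_times_mat_def sum.distrib algebra_simps)

lemma row_times_mat_diff: "row_times_mat k (\<xi> - \<eta>) A = row_times_mat k \<xi> A - row_times_mat k \<eta> A"
  by (rule ext) (simp add: row_times_mat_def sum_subtractf algebra_simps)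

lemma row_times_mat_scale: "row_times_mat k (scale_row c \<xi>) A = scale_row c (row_times_mat k \<xi> A)"
  by (rule ext) (simp add: row_times_mat_def scale_row_def sum_distrib_left algebra_simps)

lemma row_times_G_mat_in_row_vectors:
  "\<xi> \<in> row_vectors k \<Longrightarrow> row_times_mat k \<xi> (G_mat k \<pi>) \<in> row_vectors k"
  by (auto simp: row_vectors_def row_times_G_mat)

definition theta :: "(nat \<Rightarrow> 'a::field fps) \<Rightarrow> nat \<Rightarrow> 'a fps" where
  "theta \<xi> = (\<lambda>m. fps_X * fps_deriv (\<xi> m))"

lemma partial_a_eq: "partial_a k \<pi> \<xi> = theta \<xi> - row_times_mat k \<xi> (G_mat k \<pi>)"
  by (simp add: partial_a_def theta_def)

lemma theta_nth: "theta \<xi> m $ i = of_nat i * \<xi> m $ i"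
  by (cases i) (auto simp: theta_def)

lemma theta_add: "theta (\<xi> + \<eta>) = theta \<xi> + theta \<eta>"
  by (rule ext) (simp add: theta_def algebra_simps)

lemma theta_diff: "theta (\<xi> - \<eta>) = theta \<xi> - theta \<eta>"
  by (rule ext) (simp add: theta_def algebra_simps)

lemma theta_scale: "theta (scale_row c \<xi>) = scale_row c (theta \<xi>)"
  by (rule ext) (simp add: theta_def scale_row_def algebra_simps)

lemma theta_in_row_vectors: "\<xi> \<in> row_vectors k \<Longrightarrow> theta \<xi> \<in> row_vectors k"
  by (auto simp: row_vectors_def theta_def)

definition ker_mult :: "nat \<Rightarrow> 'a::field_char_0 fps \<Rightarrow> nat \<Rightarrow> 'a fps" where
  "ker_mult k h = (\<lambda>m. fps_X * h * ker_row k m)"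

lemma ker_mult_add: "ker_mult k (h + g) = ker_mult k h + ker_mult k g"
  by (rule ext) (simp add: ker_mult_def algebra_simps)

lemma ker_mult_diff: "ker_mult k (h - g) = ker_mult k h - ker_mult k g"
  by (rule ext) (simp add: ker_mult_def algebra_simps)

lemma ker_mult_0: "ker_mult k 0 = 0"
  by (rule ext) (simp add: ker_mult_def)

lemma ker_mult_in_row_vectors: "ker_mult k h \<in> row_vectors k"
  by (auto simp: row_vectors_def ker_mult_def ker_row_def)

text \<open>Trades the span for coefficient conditions that can be tested entry by entry. The bound
  on \<open>m\<close> reflects that the generators \<open>a e_(2j+1)\<close> stop at
  \<open>j < k/2\<close>.\<close>

lemma V_span_iff:
  "v \<in> V_span k \<longleftrightarrow> v \<in> row_vectors k \<and> (\<forall>m i. 2 \<le> i \<longrightarrow> v m $ i = 0) \<and>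
     (\<forall>m. (even m \<or> 2 * (k div 2) < m) \<longrightarrow> v m $ 1 = 0)"
  for v :: "nat \<Rightarrow> 'a::field fps"
proof
  let ?B = "constant_rows k \<union> {(\<lambda>m. fps_X * unit_row (2*j+1) m) |j. j < k div 2}"
  define V :: "(nat \<Rightarrow> 'a fps) set" where "V = {v. v \<in> row_vectors k \<and>
     (\<forall>m i. 2 \<le> i \<longrightarrow> v m $ i = 0) \<and>
     (\<forall>m. (even m \<or> 2 * (k div 2) < m) \<longrightarrow> v m $ 1 = 0)}"
  show "v \<in> V_span k \<Longrightarrow> v \<in> row_vectors k \<and> (\<forall>m i. 2 \<le> i \<longrightarrow> v m $ i = 0) \<and>
     (\<forall>m. (even m \<or> 2 * (k div 2) < m) \<longrightarrow> v m $ 1 = 0)"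
  proof -
    have "row.subspace V"
      by (auto simp: row.subspace_def V_def row_vectors_def scale_row_def)
    moreover have "?B \<subseteq> V"
    proof
      fix x :: "nat \<Rightarrow> 'a fps" assume "x \<in> ?B"
      then consider "x \<in> constant_rows k"
        | j where "j < k div 2" "x = (\<lambda>m. fps_X * unit_row (2*j+1) m)" by auto
      then show "x \<in> V"
      proof cases
        case 1
        then have "x m $ i = 0" if "i \<noteq> 0" for m i
          using that by (auto simp: constant_rows_def dest!: spec[of _ m])
        then show ?thesis using 1 by (simp add: V_def constant_rows_def)
      next
        case 2
        then show ?thesis by (auto simp: V_def row_vectors_def unit_row_def fps_X_def)
      qed
    qed
    ultimately have "V_span k \<subseteq> V" unfolding V_span_def by (rule row.span_minimal[rotated])
    then show "v \<in> V_span k \<Longrightarrow> ?thesis" by (auto simp: V_def)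
  qed
  assume v: "v \<in> row_vectors k \<and> (\<forall>m i. 2 \<le> i \<longrightarrow> v m $ i = 0) \<and>
     (\<forall>m. (even m \<or> 2 * (k div 2) < m) \<longrightarrow> v m $ 1 = 0)"
  \<comment> \<open>\<open>v\<close> is rebuilt from its constant part and from the generators
    \<open>u j\<close>, weighted by the linear coefficients of \<open>v\<close>.\<close>
  define c where "c = (\<lambda>m. fps_const (v m $ 0))"
  define u where "u = (\<lambda>j m. fps_X * unit_row (2*j+1) m :: 'a fps)"
  have "c \<in> constant_rows k" using v by (auto simp: constant_rows_def c_def row_vectors_def)
  then have c: "c \<in> V_span k" unfolding V_span_def by (intro row.span_base) auto
  have "u j \<in> V_span k" if "j < k div 2" for j
    unfolding V_span_def using that by (intro row.span_base) (auto simp: u_def)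
  then have s: "(\<Sum>j<k div 2. scale_row (v (2*j+1) $ 1) (u j)) \<in> V_span k"
    unfolding V_span_def by (intro row.span_sum row.span_scale) auto
  have sum_app: "(\<Sum>j\<in>A. f j) m = (\<Sum>j\<in>A. f j m)" if "finite A"
    for A :: "nat set" and f :: "nat \<Rightarrow> nat \<Rightarrow> 'a fps" and m
    using that by (induction A) auto
  have "v m = c m + (\<Sum>j<k div 2. scale_row (v (2*j+1) $ 1) (u j)) m" for m
  proof (rule fps_ext)
    fix i
    have "(\<Sum>j<k div 2. scale_row (v (2*j+1) $ 1) (u j)) m $ i
        = (\<Sum>j<k div 2. if i = 1 \<and> m = 2*j+1 then v m $ 1 else 0)"
      by (auto simp: sum_app fps_sum_nth scale_row_def u_def unit_row_def fps_X_def intro!: sum.cong)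
    also have "\<dots> = (if i = 1 then v m $ 1 else 0)"
    proof (cases "even m \<or> 2 * (k div 2) < m")
      case True
      then show ?thesis using v by (auto intro!: sum.neutral)
    next
      case False
      then have "m div 2 < k div 2" "m = 2 * (m div 2) + 1" by presburger+
      moreover have "(m = 2*j+1) \<longleftrightarrow> j = m div 2" for j using False by presburger
      ultimately show ?thesis by auto
    qed
    finally show "v m $ i = (c m + (\<Sum>j<k div 2. scale_row (v (2*j+1) $ 1) (u j)) m) $ i"
      using v by (cases "i = 0 \<or> i = 1") (auto simp: c_def)
  qed
  then have "v = c + (\<Sum>j<k div 2. scale_row (v (2*j+1) $ 1) (u j))"
    unfolding fun_eq_iff plus_fun_apply by blast
  moreover have "c + (\<Sum>j<k div 2. scale_row (v (2*j+1) $ 1) (u j)) \<in> V_span k"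
    using c s unfolding V_span_def by (rule row.span_add)
  ultimately show "v \<in> V_span k" by argo
qed

section \<open>The setting and its weighted growth estimates\<close>

locale dwork_setting = padic_complex_field p ord
  for p :: nat and ord :: "'a::{field_char_0, alg_closed_field} \<Rightarrow> ereal" +
  fixes k n :: nat and b :: real and \<pi> :: 'a
  assumes p_ge_5: "5 \<le> p"
    and pi_power: "\<pi> ^ (p - 1) = - of_nat p"
    and k_eq: "k = 2 * n"
    and k_less_p: "k < p"
    and b_gt: "1 / (real p - 1) < b"
begin

definition \<epsilon> :: real where "\<epsilon> = b - 1 / (real p - 1)"

lemma \<epsilon>_pos: "0 < \<epsilon>"
  using b_gt by (simp add: \<epsilon>_def)

lemma pi_nonzero: "\<pi> \<noteq> 0"
  using pi_power p_ge_5 by (auto simp: power_0_left)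

text \<open>Taking orders in \<open>pi_power\<close> gives \<open>(p - 1) ord \<pi> = 1\<close>. The
  value 1/(p-1) is written through \<epsilon> so that \<open>b\<close> cancels against the
  weights.\<close>

lemma ord_pi: "ord \<pi> = ereal (b - \<epsilon>)"
proof -
  obtain r where r: "ord \<pi> = ereal r" using ord_real pi_nonzero by blast
  have "ord (\<pi> ^ m) = ereal (real m * r)" for m
    by (induction m) (auto simp: ord_mult r algebra_simps)
  moreover have "ord (\<pi> ^ (p - 1)) = ereal 1"
    unfolding pi_power by (simp add: ord_p one_ereal_def)
  ultimately have "real (p - 1) * r = 1" by (metis ereal.inject)
  moreover have "real (p - 1) = real p - 1" using p_ge_5 by simp
  ultimately have "r = 1 / (real p - 1)"
    using p_ge_5 by (simp add: field_simps)
  then show ?thesis by (simp add: r \<epsilon>_def)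
qed

lemma ord_inverse_pi: "ord (1 / \<pi>) = ereal (\<epsilon> - b)"
proof -
  obtain r where r: "ord (1 / \<pi>) = ereal r" using ord_real pi_nonzero by (metis divide_eq_0_iff one_neq_zero)
  have "ord (1 / \<pi>) + ord \<pi> = 0" using ord_mult[of "1 / \<pi>" \<pi>] pi_nonzero by simp
  then show ?thesis by (simp add: r ord_pi zero_ereal_def)
qed

text \<open>
  Giving \<open>a\<close> weight \<open>2\<close> and the \<open>m\<close>-th coordinate weight \<open>m\<close>, all the growth
  conditions are linear in the total weight, and \<^const>\<open>G_mat\<close> raises it by \<open>3\<close>, that is, by \<open>b\<close>.
\<close>

definition growth :: "nat \<Rightarrow> real \<Rightarrow> 'a fps \<Rightarrow> bool" where
  "growth m \<rho> f \<longleftrightarrow> (\<forall>i. ereal (b / 3 * real (2 * i + m) + \<rho>) \<le> ord (f $ i))"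

lemma growth_0: "growth m \<rho> 0"
  by (simp add: growth_def)

lemma growth_add: "growth m \<rho> f \<Longrightarrow> growth m \<rho> g \<Longrightarrow> growth m \<rho> (f + g)"
  by (simp add: growth_def ord_ge_add)

lemma growth_diff: "growth m \<rho> f \<Longrightarrow> growth m \<rho> g \<Longrightarrow> growth m \<rho> (f - g)"
  by (simp add: growth_def ord_ge_diff)

lemma growth_mono: "growth m \<rho> f \<Longrightarrow> \<sigma> \<le> \<rho> \<Longrightarrow> growth m \<sigma> f"
  unfolding growth_def by (meson add_left_mono ereal_less_eq(3) order_trans)

lemma growth_const_mult:
  "growth m \<rho> f \<Longrightarrow> ereal r \<le> ord c \<Longrightarrow> growth m (r + \<rho>) (fps_const c * f)"
  unfolding growth_def by (auto intro: ord_ge_mult)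

text \<open>The factor \<open>a\<close> adds 2 to the weight and the move to the next entry adds 1:
  three units of b/3. In the next lemma \<open>a^2\<close> adds 4 and the move back takes 1 away,
  again three.\<close>

lemma growth_X_mult: "growth m \<rho> f \<Longrightarrow> growth (Suc m) (\<rho> - b) (fps_X * f)"
  unfolding growth_def
proof (intro allI)
  fix i assume f: "\<forall>i. ereal (b / 3 * real (2 * i + m) + \<rho>) \<le> ord (f $ i)"
  show "ereal (b / 3 * real (2 * i + Suc m) + (\<rho> - b)) \<le> ord ((fps_X * f) $ i)"
  proof (cases i)
    case (Suc j)
    have "b / 3 * real (2 * i + Suc m) + (\<rho> - b) = b / 3 * real (2 * j + m) + \<rho>"
      by (simp add: Suc algebra_simps)
    moreover have "(fps_X * f) $ i = f $ j" by (simp add: Suc)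
    ultimately show ?thesis using f by metis
  qed simp
qed

lemma growth_X2_mult: "growth (Suc m) \<rho> f \<Longrightarrow> growth m (\<rho> - b) (fps_X ^ 2 * f)"
  unfolding growth_def
proof (intro allI)
  fix i assume f: "\<forall>i. ereal (b / 3 * real (2 * i + Suc m) + \<rho>) \<le> ord (f $ i)"
  show "ereal (b / 3 * real (2 * i + m) + (\<rho> - b)) \<le> ord ((fps_X ^ 2 * f) $ i)"
  proof (cases "i < 2")
    case False
    then obtain j where j: "i = j + 2" by (metis add.commute le_Suc_ex not_less)
    have "b / 3 * real (2 * i + m) + (\<rho> - b) = b / 3 * real (2 * j + Suc m) + \<rho>"
      by (simp add: j algebra_simps)
    moreover have "(fps_X ^ 2 * f) $ i = f $ j" by (simp add: j fps_X_power_mult_nth)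
    ultimately show ?thesis using f by metis
  qed (simp add: fps_X_power_mult_nth)
qed

text \<open>The two shifts undo the two multiplications and win \<open>b\<close> back. The low
  coefficients they drop are the ones that V_k can hold.\<close>

lemma growth_shift_1: "growth (Suc m) \<rho> f \<Longrightarrow> growth m (\<rho> + b) (fps_shift 1 f)"
  unfolding growth_def
proof (intro allI)
  fix i assume f: "\<forall>i. ereal (b / 3 * real (2 * i + Suc m) + \<rho>) \<le> ord (f $ i)"
  have "b / 3 * real (2 * i + m) + (\<rho> + b) = b / 3 * real (2 * (i + 1) + Suc m) + \<rho>"
    by (simp add: algebra_simps)
  then show "ereal (b / 3 * real (2 * i + m) + (\<rho> + b)) \<le> ord (fps_shift 1 f $ i)"
    unfolding fps_shift_nth using f by metis
qed

lemma growth_shift_2: "growth m \<rho> f \<Longrightarrow> growth (Suc m) (\<rho> + b) (fps_shift 2 f)"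
  unfolding growth_def
proof (intro allI)
  fix i assume f: "\<forall>i. ereal (b / 3 * real (2 * i + m) + \<rho>) \<le> ord (f $ i)"
  have "b / 3 * real (2 * i + Suc m) + (\<rho> + b) = b / 3 * real (2 * (i + 2) + m) + \<rho>"
    by (simp add: algebra_simps)
  then show "ereal (b / 3 * real (2 * i + Suc m) + (\<rho> + b)) \<le> ord (fps_shift 2 f $ i)"
    unfolding fps_shift_nth using f by metis
qed

text \<open>This is where \<open>k < p\<close> enters: besides 2 and 3, the integers occurring in
  later denominators lie between 1 and \<open>k\<close>.\<close>

lemma ord_unit: "0 < m \<Longrightarrow> m \<le> k \<Longrightarrow> ord (of_nat m) = 0"
  using k_less_p by (intro ord_of_nat_unit) auto

lemma ord_2: "ord 2 = 0" and ord_3: "ord 3 = 0"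
  using ord_of_nat_unit[of 2] ord_of_nat_unit[of 3] p_ge_5 by auto

text \<open>The degree costs \<open>b\<close> and \<pi> returns \<open>b - \<epsilon>\<close>, a net
  loss of \<epsilon>.\<close>

lemma growth_pi_X:
  assumes "growth m (\<rho> + \<epsilon>) f"
  shows "growth (Suc m) \<rho> (fps_const (of_nat c * \<pi>) * fps_X * f)"
proof -
  have "ereal (b - \<epsilon>) \<le> ord (of_nat c * \<pi>)"
    by (rule ord_ge_mult[of 0 _ "b - \<epsilon>"]) (auto simp: ord_of_nat_nonneg ord_pi simp flip: zero_ereal_def)
  from growth_const_mult[OF growth_X_mult[OF assms] this] show ?thesis
    by (simp add: mult.assoc)
qed

lemma growth_pi_X2:
  assumes "growth (Suc m) (\<rho> + \<epsilon>) f"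
  shows "growth m \<rho> (fps_const (of_nat c * \<pi> / 3) * fps_X ^ 2 * f)"
proof -
  have "ereal (b - \<epsilon>) \<le> ord (of_nat c * \<pi>)"
    by (rule ord_ge_mult[of 0 _ "b - \<epsilon>"]) (auto simp: ord_of_nat_nonneg ord_pi simp flip: zero_ereal_def)
  then have "ereal (b - \<epsilon>) \<le> ord (of_nat c * \<pi> / 3)"
    by (simp add: ord_divide_unit ord_3)
  from growth_const_mult[OF growth_X2_mult[OF assms] this] show ?thesis
    by (simp add: mult.assoc)
qed

lemma ord_unit_div_pi: "ord u = 0 \<Longrightarrow> ord (u / \<pi>) = ereal (\<epsilon> - b)"
  using ord_mult[of u "1 / \<pi>"] by (simp add: ord_inverse_pi)

text \<open>The shift wins \<open>b\<close> and the division by \<pi> costs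
  \<open>b - \<epsilon>\<close>: this is the source of the gain that drives the contraction.\<close>

lemma growth_div_pi_shift_1:
  assumes "growth (Suc m) \<rho> f" "ord u = 0"
  shows "growth m (\<rho> + \<epsilon>) (fps_const (u / \<pi>) * fps_shift 1 f)"
  using growth_const_mult[OF growth_shift_1[OF assms(1)], of "\<epsilon> - b" "u / \<pi>"] assms(2)
  by (simp add: ord_unit_div_pi add.commute)

lemma growth_div_pi_shift_2:
  assumes "growth m \<rho> f" "ord u = 0"
  shows "growth (Suc m) (\<rho> + \<epsilon>) (fps_const (u / \<pi>) * fps_shift 2 f)"
  using growth_const_mult[OF growth_shift_2[OF assms(1)], of "\<epsilon> - b" "u / \<pi>"] assms(2)
  by (simp add: ord_unit_div_pi add.commute)

section \<open>Growth spaces of row vectors and the operators on them\<close>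

lemma M_rho_iff: "\<xi> \<in> M_rho ord k b \<rho> \<longleftrightarrow> \<xi> \<in> row_vectors k \<and> (\<forall>m. growth m \<rho> (\<xi> m))"
proof -
  have "\<xi> m \<in> L_rho ord b (\<delta> b m + \<rho>) \<longleftrightarrow> growth m \<rho> (\<xi> m)" for m
    by (simp add: L_rho_def \<delta>_def growth_def add_divide_distrib algebra_simps)
  then show ?thesis unfolding M_rho_def using growth_0
    by (auto simp: row_vectors_def)
qed

lemma M_rho_mono: "\<xi> \<in> M_rho ord k b \<rho> \<Longrightarrow> \<sigma> \<le> \<rho> \<Longrightarrow> \<xi> \<in> M_rho ord k b \<sigma>"
  by (auto simp: M_rho_iff intro: growth_mono)

lemma M_rho_add: "\<xi> \<in> M_rho ord k b \<rho> \<Longrightarrow> \<eta> \<in> M_rho ord k b \<rho> \<Longrightarrow> \<xi> + \<eta> \<in> M_rho ord k b \<rho>"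
  by (auto simp: M_rho_iff row_vectors_add growth_add)

lemma M_rho_diff: "\<xi> \<in> M_rho ord k b \<rho> \<Longrightarrow> \<eta> \<in> M_rho ord k b \<rho> \<Longrightarrow> \<xi> - \<eta> \<in> M_rho ord k b \<rho>"
  by (auto simp: M_rho_iff row_vectors_diff growth_diff)

text \<open>The operator multiplies coefficients by integers, whose orders are nonnegative. As no
  growth is lost, the perturbation cannot eat up the gain \<epsilon>.\<close>

lemma M_rho_theta:
  assumes "\<xi> \<in> M_rho ord k b \<rho>" shows "theta \<xi> \<in> M_rho ord k b \<rho>"
proof -
  have "growth m \<rho> (theta \<xi> m)" for m
    unfolding growth_def theta_nth
  proof
    fix i
    have "ereal (b / 3 * real (2 * i + m) + \<rho>) \<le> ord (\<xi> m $ i)"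
      using assms by (auto simp: M_rho_iff growth_def)
    then show "ereal (b / 3 * real (2 * i + m) + \<rho>) \<le> ord (of_nat i * \<xi> m $ i)"
      by (rule ord_ge_mult[of 0, rotated]) (auto simp: ord_of_nat_nonneg simp flip: zero_ereal_def)
  qed
  then show ?thesis using assms by (auto simp: M_rho_iff theta_in_row_vectors)
qed

lemma M_rho_G:
  assumes "\<xi> \<in> M_rho ord k b (\<rho> + \<epsilon>)"
  shows "row_times_mat k \<xi> (G_mat k \<pi>) \<in> M_rho ord k b \<rho>"
proof -
  have \<xi>: "\<xi> \<in> row_vectors k" "\<And>m. growth m (\<rho> + \<epsilon>) (\<xi> m)" using assms by (auto simp: M_rho_iff)
  have "growth m \<rho> (row_times_mat k \<xi> (G_mat k \<pi>) m)" for m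
  proof (cases "m \<in> {1..k+1}")
    case True
    then obtain l where l: "m = Suc l" by (cases m) auto
    show ?thesis
      unfolding row_times_G_mat[OF \<xi>(1)] if_P[OF True]
      by (intro growth_diff growth_pi_X2) (use \<xi>(2) in \<open>auto simp only: l diff_Suc_1 Suc_eq_plus1[symmetric] intro!: growth_pi_X\<close>)
  next
    case False
    show ?thesis unfolding row_times_G_mat[OF \<xi>(1)] if_not_P[OF False] by (rule growth_0)
  qed
  then show ?thesis using row_times_G_mat_in_row_vectors[OF \<xi>(1)] by (simp add: M_rho_iff)
qed

lemma subspace_M_sp: "row.subspace (M_sp ord k b)"
proof (rule row.subspaceI)
  show "0 \<in> M_sp ord k b"
    by (auto simp: M_sp_def M_rho_iff row_vectors_def growth_0)
  fix \<xi> assume "\<xi> \<in> M_sp ord k b"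
  then obtain \<rho> where \<xi>: "\<xi> \<in> M_rho ord k b \<rho>" by (auto simp: M_sp_def)
  {
    fix \<eta> assume "\<eta> \<in> M_sp ord k b"
    then obtain \<sigma> where \<eta>: "\<eta> \<in> M_rho ord k b \<sigma>" by (auto simp: M_sp_def)
    have "\<xi> + \<eta> \<in> M_rho ord k b (min \<rho> \<sigma>)"
      using \<xi> \<eta> by (intro M_rho_add) (auto elim: M_rho_mono)
    then show "\<xi> + \<eta> \<in> M_sp ord k b" by (auto simp: M_sp_def)
  }
  fix c
  obtain r where "ereal r \<le> ord c"
    using ord_real[of c] by (metis ereal_less_eq(1) ord_0 order_refl)
  then have "scale_row c \<xi> \<in> M_rho ord k b (r + \<rho>)"
    using \<xi> by (auto simp: M_rho_iff scale_row_def row_vectors_def intro: growth_const_mult)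
  then show "scale_row c \<xi> \<in> M_sp ord k b" by (auto simp: M_sp_def)
qed

lemma partial_a_M_sp:
  assumes "\<xi> \<in> M_sp ord k b" shows "partial_a k \<pi> \<xi> \<in> M_sp ord k b"
proof -
  obtain \<rho> where \<xi>: "\<xi> \<in> M_rho ord k b \<rho>" using assms by (auto simp: M_sp_def)
  \<comment> \<open>G costs \<epsilon> and \<open>theta\<close> nothing; both are placed at the
    weaker level \<open>\<rho> - \<epsilon>\<close>.\<close>
  have "row_times_mat k \<xi> (G_mat k \<pi>) \<in> M_rho ord k b (\<rho> - \<epsilon>)"
    using \<xi> by (intro M_rho_G) simp
  moreover have "theta \<xi> \<in> M_rho ord k b (\<rho> - \<epsilon>)"
    using M_rho_mono[OF M_rho_theta[OF \<xi>]] \<epsilon>_pos by simp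
  ultimately show ?thesis unfolding partial_a_eq M_sp_def by (blast intro: M_rho_diff)
qed

section \<open>The row kernel of G and its multiples\<close>

text \<open>The product is the falling factorial of \<open>n = k/2\<close>, so the kernel row
  consists of the terms \<open>(n choose j) (a/3)^(n-j)\<close> of a binomial expansion.\<close>

lemma K_coeff_eq: "j \<le> n \<Longrightarrow> K_coeff k j = (of_nat (n choose j) / 3 ^ (n - j) :: 'a)"
proof -
  have "(\<Prod>i=1..j. of_nat n - (of_nat i - 1) :: 'a) = (\<Prod>i=0..<j. of_nat n - of_nat i)"
    by (rule prod.reindex_bij_witness[of _ Suc "\<lambda>i. i - 1"]) auto
  then show ?thesis
    by (simp add: K_coeff_def k_eq binomial_gbinomial gbinomial_prod_rev)
qed

lemma ord_K_coeff: "j \<le> n \<Longrightarrow> 0 \<le> ord (K_coeff k j)"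
  by (simp add: K_coeff_eq ord_divide_unit ord_power_unit ord_3 ord_of_nat_nonneg)

lemma ker_mult_nth:
  assumes "j \<le> n"
  shows "ker_mult k h (2 * j + 1) $ i = (if n - j < i then K_coeff k j * h $ (i - 1 - (n - j)) else 0)"
proof -
  have *: "2 * j + 1 \<in> {1..k + 1} \<and> odd (2 * j + 1)" using assms by (simp add: k_eq)
  have "ker_mult k h (2 * j + 1) = fps_const (K_coeff k j) * (fps_X ^ Suc (n - j) * h)"
    unfolding ker_mult_def ker_row_def if_P[OF *] by (simp add: k_eq mult_ac)
  then show ?thesis by (auto simp del: power_Suc simp: fps_X_power_mult_nth)
qed

lemma ker_mult_even: "even m \<Longrightarrow> ker_mult k h m = 0"
  by (simp add: ker_mult_def ker_row_def)

text \<open>The coefficient \<open>h $ i\<close> reaches entry \<open>2j+1\<close> at degree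
  \<open>i+1+n-j\<close>, so its total weight \<open>2(i+n+1)+1\<close> does not depend on
  \<open>j\<close>, and one bound on it serves all entries.\<close>

lemma M_rho_ker_mult:
  assumes "\<And>i. ereal (b / 3 * real (2 * (i + n + 1) + 1) + \<rho>) \<le> ord (h $ i)"
  shows "ker_mult k h \<in> M_rho ord k b \<rho>"
proof -
  have "growth m \<rho> (ker_mult k h m)" for m
  proof (cases "odd m \<and> m \<le> k + 1")
    case False
    then have "ker_mult k h m = 0"
      using row_vectors_0[OF ker_mult_in_row_vectors] ker_mult_even by (meson not_le)
    then show ?thesis by (simp add: growth_0)
  next
    case True
    then obtain j where j: "m = 2 * j + 1" "j \<le> n" by (auto simp: k_eq elim!: oddE)
    show ?thesis unfolding growth_def
    proof
      fix i
      show "ereal (b / 3 * real (2 * i + m) + \<rho>) \<le> ord (ker_mult k h m $ i)"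
      proof (cases "n - j < i")
        case True
        then have "2 * i + m = 2 * ((i - 1 - (n - j)) + n + 1) + 1" using j by auto
        then have "ereal (b / 3 * real (2 * i + m) + \<rho>) \<le> ord (h $ (i - 1 - (n - j)))"
          using assms[of "i - 1 - (n - j)"] by metis
        then have "ereal (b / 3 * real (2 * i + m) + \<rho>) \<le> ord (K_coeff k j * h $ (i - 1 - (n - j)))"
          by (rule ord_ge_mult[of 0, rotated]) (use ord_K_coeff[OF j(2)] in \<open>auto simp flip: zero_ereal_def\<close>)
        then show ?thesis unfolding j(1) ker_mult_nth[OF j(2)] using True j(1) by simp
      next
        case False
        then show ?thesis unfolding j(1) ker_mult_nth[OF j(2)] by simp
      qed
    qed
  qed
  then show ?thesis by (simp add: M_rho_iff ker_mult_in_row_vectors)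
qed

lemma I_ker_eq: "I_ker ord k b = ker_mult k ` L ord b"
  by (auto simp: I_ker_def ker_mult_def)

lemma ker_mult_M_sp:
  assumes "h \<in> L ord b" shows "ker_mult k h \<in> M_sp ord k b"
proof -
  obtain \<rho> where \<rho>: "\<And>i. ereal (2 * b / 3 * real i + \<rho>) \<le> ord (h $ i)"
    using assms by (auto simp: L_def L_rho_def)
  \<comment> \<open>\<open>2n+3\<close> is the total weight at \<open>i = 0\<close>.\<close>
  have "ker_mult k h \<in> M_rho ord k b (\<rho> - b / 3 * real (2 * n + 3))"
    using \<rho> by (intro M_rho_ker_mult) (simp add: algebra_simps add_divide_distrib)
  then show ?thesis by (auto simp: M_sp_def)
qed

section \<open>The pairing with the column kernel of G\<close>

text \<open>
  The row vector with odd entries \<open>W j * a ^ j\<close> spans the kernel of \<^const>\<open>G_mat\<close> acting on columns;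
  pairing with it isolates the \<open>ker_mult\<close> component of a row vector.
\<close>

definition W :: "nat \<Rightarrow> 'a" where
  "W j = (\<Prod>i<j. of_nat (2 * i + 1) / (3 * of_nat (2 * n - 2 * i - 1)))"

text \<open>The coefficient of \<open>a^(n+1+i)\<close> in the product with the column
  \<open>W j a^j\<close>. The offset \<open>n+1\<close> is the degree at which multiples
  \<open>a h k\<close> of the kernel row begin to contribute.\<close>

definition pairing :: "nat \<Rightarrow> (nat \<Rightarrow> 'a fps) \<Rightarrow> 'a" where
  "pairing i \<xi> = (\<Sum>j\<le>n. W j * \<xi> (2 * j + 1) $ (n + 1 + i - j))"

text \<open>The product of the two kernel vectors is \<open>S a^n\<close>, since
  \<open>W j a^j\<close> meets \<open>a^(n-j)\<close> in every term.\<close>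

definition S :: 'a where
  "S = (\<Sum>j\<le>n. W j * K_coeff k j)"

text \<open>This recurrence says that row \<open>2j+2\<close> of G annihilates the column.\<close>

lemma W_Suc: "j < n \<Longrightarrow> W (Suc j) * of_nat (2 * n - 2 * j - 1) = of_nat (2 * j + 1) / 3 * W j"
proof -
  assume "j < n"
  then have "(of_nat (2 * n - 2 * j - 1) :: 'a) \<noteq> 0" unfolding of_nat_eq_0_iff by simp
  moreover have "W (Suc j) = W j * (of_nat (2 * j + 1) / (3 * of_nat (2 * n - 2 * j - 1)))"
    by (simp add: W_def)
  ultimately show ?thesis by (simp del: of_nat_add of_nat_mult of_nat_diff of_nat_Suc)
qed

lemma ord_W:
  assumes "j \<le> n" shows "ord (W j) = 0"
  unfolding W_def
proof (rule ord_prod_unit)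
  fix i assume "i \<in> {..<j}"
  then have "ord (of_nat (2 * i + 1)) = 0" "ord (of_nat (2 * n - 2 * i - 1)) = 0"
    using assms by (intro ord_unit; simp add: k_eq)+
  then show "ord (of_nat (2 * i + 1) / (3 * of_nat (2 * n - 2 * i - 1))) = 0"
    by (metis ord_divide_unit ord_mult_unit ord_3)
qed

lemma pairing_add: "pairing i (\<xi> + \<eta>) = pairing i \<xi> + pairing i \<eta>"
  by (simp add: pairing_def algebra_simps sum.distrib)

lemma pairing_diff: "pairing i (\<xi> - \<eta>) = pairing i \<xi> - pairing i \<eta>"
  by (simp add: pairing_def algebra_simps sum_subtractf)

text \<open>The sum telescopes: by \<open>W_Suc\<close>, what \<open>\<eta> (2j+2)\<close>
  contributes through entry \<open>2j+1\<close> cancels what it contributes through entry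
  \<open>2j+3\<close>. The ends vanish because entries 0 and \<open>k+2\<close> lie outside the
  row.\<close>

lemma pairing_G:
  assumes "\<eta> \<in> row_vectors k" shows "pairing i (row_times_mat k \<eta> (G_mat k \<pi>)) = 0"
proof -
  define T where "T = (\<lambda>j. W j * (of_nat (k + 1 - 2 * j) * \<pi>) * \<eta> (2 * j) $ (n + i - j))"
  have "W j * row_times_mat k \<eta> (G_mat k \<pi>) (2 * j + 1) $ (n + 1 + i - j) = T j - T (Suc j)"
    if j: "j \<le> n" for j
  proof -
    have m: "2 * j + 1 \<in> {1..k + 1}" using j by (simp add: k_eq)
    have 1: "(fps_const (of_nat (k + 2 - (2 * j + 1)) * \<pi>) * fps_X * \<eta> (2 * j + 1 - 1)) $ (n + 1 + i - j)
        = of_nat (k + 1 - 2 * j) * \<pi> * \<eta> (2 * j) $ (n + i - j)"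
      using j by (simp add: mult.assoc Suc_diff_le)
    have 2: "W j * (fps_const (of_nat (2 * j + 1) * \<pi> / 3) * fps_X ^ 2 * \<eta> (2 * j + 1 + 1)) $ (n + 1 + i - j)
        = T (Suc j)"
    \<comment> \<open>The recurrence for \<open>W\<close> stops at \<open>j < n\<close>; at
      \<open>j = n\<close> both sides vanish through entry \<open>k+2\<close>.\<close>
    proof (cases "j = n")
      case True
      then show ?thesis using row_vectors_0[OF assms, of "2 * n + 2"] by (simp add: T_def k_eq)
    next
      case False
      then have "j < n" using j by simp
      then have "(fps_const (of_nat (2 * j + 1) * \<pi> / 3) * fps_X ^ 2 * \<eta> (2 * j + 1 + 1)) $ (n + 1 + i - j)
          = of_nat (2 * j + 1) * \<pi> / 3 * \<eta> (2 * j + 2) $ (n + i - Suc j)"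
        unfolding mult.assoc fps_mult_left_const_nth fps_X_power_mult_nth
        by (simp add: Suc_diff_Suc numeral_2_eq_2)
      moreover have "T (Suc j) = of_nat (2 * j + 1) / 3 * W j * \<pi> * \<eta> (2 * j + 2) $ (n + i - Suc j)"
        unfolding T_def W_Suc[OF \<open>j < n\<close>, symmetric] by (simp add: k_eq)
      ultimately show ?thesis by (simp only: mult_ac times_divide_eq_right times_divide_eq_left)
    qed
    show ?thesis
      unfolding row_times_G_mat[OF assms] if_P[OF m] fps_sub_nth right_diff_distrib 1 2
      by (simp add: T_def mult.assoc)
  qed
  then have "pairing i (row_times_mat k \<eta> (G_mat k \<pi>)) = (\<Sum>j<Suc n. T j - T (Suc j))"
    by (auto simp: pairing_def lessThan_Suc_atMost intro!: sum.cong)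
  also have "\<dots> = T 0 - T (Suc n)"
    by (rule sum_lessThan_telescope')
  also have "\<dots> = 0"
    using row_vectors_0[OF assms, of 0] row_vectors_0[OF assms, of "2 * n + 2"] by (simp add: T_def k_eq)
  finally show ?thesis .
qed

lemma pairing_ker_mult: "pairing i (ker_mult k h) = S * h $ i"
proof -
  have "ker_mult k h (2 * j + 1) $ (n + 1 + i - j) = K_coeff k j * h $ i" if "j \<le> n" for j
  proof -
    have "n - j < n + 1 + i - j" "n + 1 + i - j - 1 - (n - j) = i" using that by auto
    then show ?thesis unfolding ker_mult_nth[OF that] by simp
  qed
  then show ?thesis unfolding pairing_def S_def sum_distrib_right by (intro sum.cong) auto
qed

text \<open>Every exponent involved is at least 2, except for \<open>j = n\<close>,
  \<open>i = 0\<close>. That case asks for the linear term of the last entry, which V_k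
  excludes.\<close>

lemma pairing_V_span:
  assumes "v \<in> V_span k" shows "pairing i v = 0"
  unfolding pairing_def
proof (intro sum.neutral ballI)
  fix j assume j: "j \<in> {..n}"
  have "v (2 * j + 1) $ (n + 1 + i - j) = 0"
  proof (cases "2 \<le> n + 1 + i - j")
    case True then show ?thesis using assms unfolding V_span_iff by blast
  next
    case False
    then have "j = n" "i = 0" using j by auto
    then show ?thesis using assms unfolding V_span_iff by (simp add: k_eq)
  qed
  then show "W j * v (2 * j + 1) $ (n + 1 + i - j) = 0" by simp
qed

text \<open>A closed form of \<open>W\<close>, kept free of denominators, which turns
  \<open>S\<close> into a Vandermonde convolution.\<close>

lemma W_pochhammer:
  "j \<le> n \<Longrightarrow> W j * 3 ^ j * pochhammer (1 / 2) n = pochhammer (1 / 2) j * pochhammer (1 / 2) (n - j)"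
proof (induction j)
  case 0
  then show ?case by (simp add: W_def)
next
  case (Suc j)
  define c :: 'a where "c = of_nat (2 * n - 2 * j - 1)"
  have c: "c \<noteq> 0" using Suc.prems unfolding c_def of_nat_eq_0_iff by simp
  have "(1 / 2 + of_nat (n - Suc j) :: 'a) = c / 2"
  proof -
    have "2 * n - 2 * j - 1 = 2 * (n - Suc j) + 1" using Suc.prems by simp
    then show ?thesis unfolding c_def by (simp only:) (simp add: field_simps)
  qed
  then have p: "pochhammer (1 / 2) (n - j) = pochhammer (1 / 2) (n - Suc j) * (c / 2)"
    using Suc.prems pochhammer_Suc[of "1 / 2 :: 'a" "n - Suc j"] by (simp add: Suc_diff_Suc)
  \<comment> \<open>The claim is proved after multiplication by \<open>c\<close>, so that the
    recurrence applies; \<open>c\<close> is cancelled at the end.\<close>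
  have w: "W (Suc j) * c = of_nat (2 * j + 1) / 3 * W j"
    using W_Suc[of j] Suc.prems by (simp add: c_def)
  have "(W (Suc j) * 3 ^ Suc j * pochhammer (1 / 2) n) * c
      = (W (Suc j) * c) * 3 * 3 ^ j * pochhammer (1 / 2) n" by simp
  also have "\<dots> = of_nat (2 * j + 1) * (W j * 3 ^ j * pochhammer (1 / 2) n)"
    unfolding w by simp
  also have "\<dots> = of_nat (2 * j + 1) * (pochhammer (1 / 2) j * pochhammer (1 / 2) (n - j))"
    using Suc by simp
  also have "\<dots> = (pochhammer (1 / 2) (Suc j) * pochhammer (1 / 2) (n - Suc j)) * c"
    unfolding p pochhammer_Suc by (simp add: field_simps)
  finally show ?case using c by simp
qed

text \<open>Vandermonde for rising factorials with both parameters 1/2: the sum is the rising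
  factorial of 1, that is \<open>n!\<close>.\<close>

lemma S_eq: "S * 3 ^ n * pochhammer (1 / 2) n = fact n"
proof -
  have "S * 3 ^ n * pochhammer (1 / 2) n
      = (\<Sum>j\<le>n. of_nat (n choose j) * pochhammer (1 / 2) j * pochhammer (1 / 2) (n - j))"
    unfolding S_def sum_distrib_right
  proof (rule sum.cong)
    fix j assume "j \<in> {..n}"
    then have j: "j \<le> n" by simp
    then have "(3 ^ n :: 'a) = 3 ^ (n - j) * 3 ^ j" by (simp flip: power_add)
    then have "W j * K_coeff k j * 3 ^ n * pochhammer (1 / 2) n
        = of_nat (n choose j) * (W j * 3 ^ j * pochhammer (1 / 2) n)"
      by (simp add: K_coeff_eq[OF j])
    then show "W j * K_coeff k j * 3 ^ n * pochhammer (1 / 2) n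
        = of_nat (n choose j) * pochhammer (1 / 2) j * pochhammer (1 / 2) (n - j)"
      by (simp add: W_pochhammer[OF j])
  qed simp
  also have "\<dots> = pochhammer (1 / 2 + 1 / 2) n"
    by (rule pochhammer_binomial_sum[symmetric])
  finally show ?thesis by (simp add: pochhammer_fact)
qed

text \<open>In \<open>S_eq\<close> everything but \<open>S\<close> is a unit: \<open>n!\<close> and
  the odd numerators in the rising factorial of 1/2 have factors below \<open>p\<close>, and 2 and 3
  are units.\<close>

lemma ord_S: "ord S = 0"
proof -
  have "ord (of_nat (2 * i + 1) / 2) = 0" if "i < n" for i
    using that by (subst ord_divide_unit[OF ord_2], intro ord_unit) (auto simp: k_eq)
  moreover have "(1 / 2 + of_nat i :: 'a) = of_nat (2 * i + 1) / 2" for i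
    by (simp add: field_simps)
  ultimately have "ord (pochhammer (1 / 2) n) = 0"
    unfolding pochhammer_prod by (intro ord_prod_unit) (simp only: atLeastLessThan_iff)
  then have "ord (S * 3 ^ n * pochhammer (1 / 2) n) = ord S"
    by (simp add: ord_mult ord_power_unit ord_3)
  moreover have "ord (fact n) = 0"
    unfolding fact_prod of_nat_prod by (intro ord_prod_unit ord_unit) (auto simp: k_eq)
  ultimately show ?thesis by (simp add: S_eq)
qed

lemma S_nonzero: "S \<noteq> 0"
  using ord_S by auto

section \<open>The algebraic decomposition along G\<close>

text \<open>The pairing kills the first two terms, so \<open>h = 0\<close>. Then \<eta> vanishes
  entry by entry: upwards from entry 0 through the even ones, downwards from entry
  \<open>k+1\<close> through the odd ones.\<close>

lemma decomposition_unique: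
  assumes v: "v \<in> V_span k" and \<eta>: "\<eta> \<in> row_vectors k" "\<eta> (k + 1) = 0"
    and eq: "v + row_times_mat k \<eta> (G_mat k \<pi>) + ker_mult k h = 0"
  shows "v = 0" "\<eta> = 0" "h = 0"
proof -
  have "S * h $ i = 0" for i
  proof -
    have "pairing i (v + row_times_mat k \<eta> (G_mat k \<pi>) + ker_mult k h) = S * h $ i"
      by (simp add: pairing_add pairing_G[OF \<eta>(1)] pairing_ker_mult pairing_V_span[OF v])
    then show ?thesis unfolding eq by (simp add: pairing_def)
  qed
  then show "h = 0" using S_nonzero by (simp add: fps_eq_iff)
  then have "v + row_times_mat k \<eta> (G_mat k \<pi>) = 0" using eq by (simp add: ker_mult_0)
  then have v_eq: "v = - row_times_mat k \<eta> (G_mat k \<pi>)" by (simp add: eq_neg_iff_add_eq_0)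
  have vm: "v m = fps_const (of_nat m * \<pi> / 3) * fps_X ^ 2 * \<eta> (m + 1)
      - fps_const (of_nat (k + 2 - m) * \<pi>) * fps_X * \<eta> (m - 1)" if "m \<in> {1..k+1}" for m
    unfolding v_eq uminus_apply row_times_G_mat[OF \<eta>(1)] if_P[OF that] by simp
  have even: "\<eta> (2 * j) = 0" if "j \<le> n" for j
    using that
  proof (induction j)
    case 0
    then show ?case using row_vectors_0[OF \<eta>(1)] by simp
  next
    case (Suc j)
    then have "v (2 * j + 1) = fps_const (of_nat (2 * j + 1) * \<pi> / 3) * (fps_X ^ 2 * \<eta> (2 * Suc j))"
      using vm[of "2 * j + 1"] by (simp add: k_eq mult.assoc)
    \<comment> \<open>The factor \<open>a^2\<close> puts the next even entry of \<eta> at exponents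
      from 2 on, where V_k has nothing.\<close>
    then have "v (2 * j + 1) $ (i + 2) = of_nat (2 * j + 1) * \<pi> / 3 * \<eta> (2 * Suc j) $ i" for i
      by (simp only: fps_mult_left_const_nth fps_X_power_mult_nth) simp
    moreover have "v (2 * j + 1) $ (i + 2) = 0" for i
      using v unfolding V_span_iff by simp
    moreover have "(of_nat (2 * j + 1) :: 'a) \<noteq> 0" unfolding of_nat_eq_0_iff by simp
    ultimately show ?case using pi_nonzero by (simp add: fps_eq_iff del: of_nat_add of_nat_mult)
  qed
  \<comment> \<open>Here \<open>j\<close> counts from the end, starting at the entry assumed to be
    zero. Even entries of V_k are constant, so a factor \<open>a\<close> suffices.\<close>
  have odd: "\<eta> (2 * (n - j) + 1) = 0" if "j \<le> n" for j
    using that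
  proof (induction j)
    case 0
    then show ?case using \<eta>(2) by (simp add: k_eq)
  next
    case (Suc j)
    define m where "m = 2 * (n - j)"
    have m: "m \<in> {1..k + 1}" "m - 1 = 2 * (n - Suc j) + 1" "even m"
      using Suc.prems by (auto simp: m_def k_eq)
    have 0: "\<eta> (m + 1) = 0" using Suc by (simp add: m_def)
    have "v m = - (fps_const (of_nat (k + 2 - m) * \<pi>) * (fps_X * \<eta> (m - 1)))"
      unfolding vm[OF m(1)] 0 by (simp add: mult.assoc)
    then have "v m $ (i + 1) = - (of_nat (k + 2 - m) * \<pi> * \<eta> (m - 1) $ i)" for i
      by simp
    moreover have "v m $ (i + 1) = 0" for i
      using v m(3) unfolding V_span_iff by (cases i) auto
    moreover have "(of_nat (k + 2 - m) :: 'a) \<noteq> 0"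
      using m(1) unfolding of_nat_eq_0_iff by simp
    ultimately have "\<eta> (m - 1) = 0" using pi_nonzero by (simp add: fps_eq_iff)
    then show ?case unfolding m(2) .
  qed
  have "\<eta> m = 0" for m
  proof (cases "m \<le> k + 1")
    case True
    show ?thesis
    proof (cases "even m")
      case True
      then show ?thesis using even[of "m div 2"] \<open>m \<le> k + 1\<close> by (auto simp: k_eq)
    next
      case False
      then show ?thesis using odd[of "n - m div 2"] \<open>m \<le> k + 1\<close> by (auto simp: k_eq elim!: oddE)
    qed
  qed (use row_vectors_0[OF \<eta>(1)] in auto)
  then show "\<eta> = 0" by (simp add: fun_eq_iff)
  then show "v = 0" unfolding v_eq by (simp add: fun_eq_iff row_times_mat_def)
qed

text \<open>Each entry but the last leaves one new entry of \<eta> to absorb whatever V_k cannot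
  hold; the last relies on \<open>h\<close>. The growth clause ranges over all \<rho> after \<eta>
  is chosen, so one \<eta> serves the rising levels of the contraction.\<close>

lemma decomposition_exists:
  assumes \<xi>: "\<xi> \<in> row_vectors k"
  shows "\<exists>v\<in>V_span k. \<exists>\<eta>\<in>row_vectors k. \<exists>h. \<eta> (k + 1) = 0 \<and>
    \<xi> = v + row_times_mat k \<eta> (G_mat k \<pi>) + ker_mult k h \<and>
    (\<forall>\<rho>. \<xi> \<in> M_rho ord k b \<rho> \<longrightarrow> \<eta> \<in> M_rho ord k b (\<rho> + \<epsilon>) \<and> h \<in> L ord b)"
proof -
  \<comment> \<open>Forced: the other two summands pair to zero and the third to \<open>S\<close>
    times the coefficient.\<close>
  define h where "h = Abs_fps (\<lambda>i. pairing i \<xi> / S)"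
  \<comment> \<open>With \<open>x\<close> in the role of \<open>\<eta> (2j)\<close>, this is entry
    \<open>2j+1\<close> before \<open>\<eta> (2j+2)\<close> acts. Next, \<open>g\<close> solves for
    that entry, leaving the coefficients 0 and 1 to \<open>v\<close>.\<close>
  define f where "f = (\<lambda>j x. \<xi> (2 * j + 1) - ker_mult k h (2 * j + 1)
    - fps_const (of_nat (k + 1 - 2 * j) * \<pi>) * fps_X * x)"
  define g where "g = rec_nat 0 (\<lambda>j x. fps_const (- 3 / of_nat (2 * j + 1) / \<pi>) * fps_shift 2 (f j x))"
  \<comment> \<open>Entry \<open>2(n-j)\<close> before \<open>\<eta> (2(n-j)-1)\<close> acts, with
    \<open>x\<close> in the role of \<open>\<eta> (2(n-j)+1)\<close>; the kernel row has no even
    entries. Then \<open>e\<close> solves for the odd entries, counted from the end.\<close>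
  define q where "q = (\<lambda>j x. \<xi> (2 * (n - j))
    + fps_const (of_nat (2 * (n - j)) * \<pi> / 3) * fps_X ^ 2 * x)"
  define e where "e = rec_nat 0 (\<lambda>j x. fps_const (1 / of_nat (2 * j + 2) / \<pi>) * fps_shift 1 (q j x))"
  have g: "g 0 = 0" "\<And>j. g (Suc j) = fps_const (- 3 / of_nat (2 * j + 1) / \<pi>) * fps_shift 2 (f j (g j))"
    and e: "e 0 = 0" "\<And>j. e (Suc j) = fps_const (1 / of_nat (2 * j + 2) / \<pi>) * fps_shift 1 (q j (e j))"
    by (simp_all add: g_def e_def)
  define \<eta> where "\<eta> = (\<lambda>m. if m = 0 \<or> k < m then 0 else if even m then g (m div 2) else e (n - m div 2))"
  have \<eta>_even: "\<eta> (2 * j) = g j" if "j \<le> n" for j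
    using that g(1) by (auto simp: \<eta>_def k_eq)
  have \<eta>_odd: "\<eta> (2 * j + 1) = e (n - j)" if "j \<le> n" for j
    using that e(1) by (cases "j = n") (auto simp: \<eta>_def k_eq)
  have \<eta>: "\<eta> \<in> row_vectors k" "\<eta> (k + 1) = 0"
    by (auto simp: \<eta>_def row_vectors_def)
  define v where "v = \<xi> - row_times_mat k \<eta> (G_mat k \<pi>) - ker_mult k h"
  have v_row: "v \<in> row_vectors k"
    unfolding v_def by (intro row_vectors_diff \<xi> row_times_G_mat_in_row_vectors \<eta> ker_mult_in_row_vectors)
  have vm: "v m = \<xi> m - ker_mult k h m - fps_const (of_nat (k + 2 - m) * \<pi>) * fps_X * \<eta> (m - 1)
      + fps_const (of_nat m * \<pi> / 3) * fps_X ^ 2 * \<eta> (m + 1)" if "m \<in> {1..k+1}" for m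
    unfolding v_def minus_apply row_times_G_mat[OF \<eta>(1)] if_P[OF that] by simp
  have v_odd: "v (2 * j + 1) $ (i + 2) = 0" if "j < n" for j i
  proof -
    have nz: "(of_nat (2 * j + 1) :: 'a) \<noteq> 0" unfolding of_nat_eq_0_iff by simp
    have "v (2 * j + 1) = f j (g j) + fps_const (of_nat (2 * j + 1) * \<pi> / 3) * (fps_X ^ 2 * g (Suc j))"
      using that vm[of "2 * j + 1"] \<eta>_even[of j] \<eta>_even[of "Suc j"]
      by (simp add: f_def k_eq mult.assoc)
    then show ?thesis
      using pi_nonzero nz unfolding g(2)
      by (simp add: fps_X_power_mult_nth del: of_nat_add of_nat_mult)
  qed
  have v_even: "v (2 * (n - j)) $ (i + 1) = 0" if "j < n" for j i
  proof -
    define m where "m = 2 * (n - j)"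
    have m: "m \<in> {1..k + 1}" "m - 1 = 2 * (n - Suc j) + 1" "even m" "k + 2 - m = 2 * j + 2"
      using that by (auto simp: m_def k_eq)
    have nz: "(of_nat (2 * j + 2) :: 'a) \<noteq> 0" unfolding of_nat_eq_0_iff by simp
    have "\<eta> (m - 1) = e (Suc j)" "\<eta> (m + 1) = e j"
      using that \<eta>_odd[of "n - Suc j"] \<eta>_odd[of "n - j"] unfolding m(2) by (simp_all add: m_def)
    then have "v m = q j (e j) - fps_const (of_nat (2 * j + 2) * \<pi>) * (fps_X * e (Suc j))"
      unfolding vm[OF m(1)] m(4) ker_mult_even[OF m(3)] by (simp add: q_def m_def mult.assoc)
    then show ?thesis
      using pi_nonzero nz unfolding e(2) m_def[symmetric]
      by (simp del: of_nat_add of_nat_mult)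
  qed
  \<comment> \<open>No entry of \<eta> is left to correct the last coordinate. The choice of
    \<open>h\<close> makes \<open>v\<close> pair to zero, and by \<open>v_odd\<close> only the last
    term of that pairing survives.\<close>
  have v_last: "v (2 * n + 1) $ (i + 1) = 0" for i
  proof -
    have "pairing i v = 0"
      using S_nonzero unfolding v_def pairing_diff pairing_G[OF \<eta>(1)] pairing_ker_mult
      by (simp add: h_def)
    moreover have "pairing i v = (\<Sum>j\<le>n. if j = n then W n * v (2 * n + 1) $ (i + 1) else 0)"
      unfolding pairing_def
    proof (intro sum.cong refl)
      fix j assume "j \<in> {..n}"
      then consider "j = n" | "j < n" by force
      then show "W j * v (2 * j + 1) $ (n + 1 + i - j) = (if j = n then W n * v (2 * n + 1) $ (i + 1) else 0)"
      proof cases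
        case 2
        then have "n + 1 + i - j = (n - 1 + i - j) + 2" by simp
        then show ?thesis using v_odd[OF 2] 2 by simp
      qed simp
    qed
    ultimately have "W n * v (2 * n + 1) $ (i + 1) = 0" by simp
    moreover have "W n \<noteq> 0" using ord_W[of n] by auto
    ultimately show ?thesis by simp
  qed
  have "v \<in> V_span k"
  proof -
    have ev: "v m $ (i + 1) = 0" if "even m \<or> 2 * n < m" for m i
    proof -
      have "(m = 0 \<or> k + 1 < m) \<or> m = 2 * n + 1 \<or> (even m \<and> 0 < m \<and> m \<le> 2 * n)"
        using that unfolding k_eq by presburger
      then consider "m = 0 \<or> k + 1 < m" | "m = 2 * n + 1" | "even m" "0 < m" "m \<le> 2 * n"
        by blast
      then show ?thesis
      proof cases
        case 1 then show ?thesis using row_vectors_0[OF v_row] by simp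
      next
        case 2 then show ?thesis using v_last by simp
      next
        case 3
        then obtain j where "m = 2 * j" "0 < j" "j \<le> n" by auto
        then show ?thesis using v_even[of "n - j"] by simp
      qed
    qed
    have "v m $ i = 0" if "2 \<le> i" for m i
    proof (cases "even m \<or> 2 * n < m")
      case True then show ?thesis using ev[of m "i - 1"] that by simp
    next
      case False
      then obtain j where "m = 2 * j + 1" "j < n" by (auto elim!: oddE)
      moreover have "i = (i - 2) + 2" using that by simp
      ultimately show ?thesis using v_odd by metis
    qed
    then show ?thesis unfolding V_span_iff using v_row ev[of _ 0] by (simp add: k_eq)
  qed
  moreover have "\<xi> = v + row_times_mat k \<eta> (G_mat k \<pi>) + ker_mult k h" by (simp add: v_def)
  moreover have "\<eta> \<in> M_rho ord k b (\<rho> + \<epsilon>) \<and> h \<in> L ord b" if M: "\<xi> \<in> M_rho ord k b \<rho>" for \<rho>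
  proof -
    have \<xi>_growth: "growth m \<rho> (\<xi> m)" for m using M by (simp add: M_rho_iff)
    \<comment> \<open>All terms of the pairing have the same total weight, and \<open>W j\<close>
      and \<open>S\<close> are units.\<close>
    have h_ord: "ereal (b / 3 * real (2 * (i + n + 1) + 1) + \<rho>) \<le> ord (h $ i)" for i
    proof -
      have "ereal (b / 3 * real (2 * (i + n + 1) + 1) + \<rho>) \<le> ord (pairing i \<xi>)"
        unfolding pairing_def
      proof (rule ord_ge_sum)
        fix j assume "j \<in> {..n}"
        then have j: "2 * (i + n + 1) + 1 = 2 * (n + 1 + i - j) + (2 * j + 1)" "j \<le> n" by auto
        have "ereal (b / 3 * real (2 * (i + n + 1) + 1) + \<rho>) \<le> ord (\<xi> (2 * j + 1) $ (n + 1 + i - j))"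
          unfolding j(1) using \<xi>_growth[of "2 * j + 1"] unfolding growth_def by blast
        then show "ereal (b / 3 * real (2 * (i + n + 1) + 1) + \<rho>)
            \<le> ord (W j * \<xi> (2 * j + 1) $ (n + 1 + i - j))"
          by (simp add: ord_mult ord_W[OF j(2)])
      qed
      then show ?thesis by (simp add: h_def ord_divide_unit[OF ord_S])
    qed
    have "h \<in> L_rho ord b (b / 3 * real (2 * n + 3) + \<rho>)"
      unfolding L_rho_def using h_ord by (simp add: algebra_simps add_divide_distrib)
    then have h: "h \<in> L ord b" by (auto simp: L_def)
    have ker: "growth m \<rho> (ker_mult k h m)" for m
      using M_rho_ker_mult[OF h_ord] by (simp add: M_rho_iff)
    \<comment> \<open>Multiplying by \<pi> \<open>a\<close> loses \<epsilon> and the division by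
      \<pi> \<open>a^2\<close> regains it, so the level does not sink along the recursion.\<close>
    have g_growth: "growth (2 * j) (\<rho> + \<epsilon>) (g j)" if "j \<le> n" for j
      using that
    proof (induction j)
      case 0
      then show ?case by (simp add: g growth_0)
    next
      case (Suc j)
      have "growth (2 * j + 1) \<rho> (f j (g j))"
        unfolding f_def
        by (intro growth_diff \<xi>_growth ker) (use growth_pi_X[of "2 * j"] Suc in simp)
      moreover have "ord (- 3 / of_nat (2 * j + 1)) = 0"
        using Suc.prems by (subst ord_divide_unit[OF ord_unit]) (auto simp: k_eq ord_3)
      ultimately have "growth (Suc (2 * j + 1)) (\<rho> + \<epsilon>) (g (Suc j))"
        unfolding g(2) by (rule growth_div_pi_shift_2)
      then show ?case by simp
    qed
    have e_growth: "growth (2 * (n - j) + 1) (\<rho> + \<epsilon>) (e j)" if "j \<le> n" for j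
      using that
    proof (induction j)
      case 0
      then show ?case by (simp add: e growth_0)
    next
      case (Suc j)
      have "growth (2 * (n - j)) \<rho> (q j (e j))"
        unfolding q_def
        by (intro growth_add \<xi>_growth growth_pi_X2) (use Suc in simp)
      moreover have "2 * (n - j) = Suc (2 * (n - Suc j) + 1)" using Suc.prems by simp
      ultimately have "growth (Suc (2 * (n - Suc j) + 1)) \<rho> (q j (e j))" by simp
      moreover have "ord (1 / of_nat (2 * j + 2)) = 0"
        using Suc.prems by (subst ord_divide_unit[OF ord_unit]) (auto simp: k_eq)
      ultimately show ?case
        unfolding e(2) by (rule growth_div_pi_shift_1)
    qed
    have "growth m (\<rho> + \<epsilon>) (\<eta> m)" for m
    proof (cases "m \<le> k")
      case True
      show ?thesis
      proof (cases "even m")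
        case True
        then obtain j where "m = 2 * j" "j \<le> n" using \<open>m \<le> k\<close> by (auto simp: k_eq)
        then show ?thesis using g_growth \<eta>_even by simp
      next
        case False
        then obtain j where j: "m = 2 * j + 1" "j \<le> n" using \<open>m \<le> k\<close> by (auto simp: k_eq elim!: oddE)
        then show ?thesis using e_growth[of "n - j"] unfolding j(1) \<eta>_odd[OF j(2)] by simp
      qed
    next
      case False then show ?thesis by (simp add: \<eta>_def growth_0)
    qed
    then show ?thesis using h \<eta>(1) by (simp add: M_rho_iff)
  qed
  ultimately show ?thesis using \<eta> by blast
qed

section \<open>Completeness and the contraction argument\<close>

lemma M_rho_all_0:
  assumes "\<And>t::nat. \<xi> \<in> M_rho ord k b (\<rho> + real t * \<epsilon>)" shows "\<xi> = 0"
proof -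
  have "\<xi> m $ i = 0" for m i
  proof (rule eq_0_if_ord_unbounded[OF _ \<epsilon>_pos])
    show "ereal (b / 3 * real (2 * i + m) + \<rho> + real t * \<epsilon>) \<le> ord (\<xi> m $ i)" for t
      using assms[of t] unfolding M_rho_iff growth_def add.assoc by blast
  qed
  then show ?thesis by (simp add: fun_eq_iff fps_eq_iff)
qed

text \<open>Each coefficient is a Cauchy sequence in a complete field. The ultrametric inequality
  carries the estimates to the limit without loss.\<close>

lemma M_rho_limit:
  assumes row: "\<And>t::nat. X t \<in> row_vectors k"
    and step: "\<And>t. X (Suc t) - X t \<in> M_rho ord k b (\<rho> + real t * \<epsilon>)"
  obtains Y where "\<And>t. Y - X t \<in> M_rho ord k b (\<rho> + real t * \<epsilon>)"
proof -
  have diff: "X (s + d) - X s \<in> M_rho ord k b (\<rho> + real s * \<epsilon>)" for s d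
  proof (induction d)
    case 0
    have "X (s + 0) - X s = (X (Suc s) - X s) - (X (Suc s) - X s)" by simp
    then show ?case using M_rho_diff[OF step step] by metis
  next
    case (Suc d)
    have "X (Suc (s + d)) - X (s + d) \<in> M_rho ord k b (\<rho> + real s * \<epsilon>)"
      by (rule M_rho_mono[OF step]) (use \<epsilon>_pos in simp)
    from M_rho_add[OF this Suc]
    have "(X (Suc (s + d)) - X (s + d)) + (X (s + d) - X s) \<in> M_rho ord k b (\<rho> + real s * \<epsilon>)" .
    moreover have "X (s + Suc d) - X s = (X (Suc (s + d)) - X (s + d)) + (X (s + d) - X s)" by simp
    ultimately show ?case by (rule ssubst[rotated])
  qed
  define w where "w = (\<lambda>m i s. b / 3 * real (2 * i + m) + (\<rho> + real s * \<epsilon>))"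
  have ord_diff: "ereal (w m i s) \<le> ord (X t m $ i - X s m $ i)" if "s \<le> t" for m i s t
    using diff[of s "t - s"] that by (simp add: M_rho_iff growth_def w_def)
  have w_large: "\<exists>s. c \<le> w m i s" for c m i
  proof -
    obtain s :: nat where "c - (b / 3 * real (2 * i + m) + \<rho>) < real s * \<epsilon>"
      using reals_Archimedean3[OF \<epsilon>_pos] by blast
    then show ?thesis by (intro exI[of _ s]) (simp add: w_def)
  qed
  have "\<exists>y. ord_converges (\<lambda>t. X t m $ i) y" for m i
  proof (rule complete, unfold ord_Cauchy_def, intro allI)
    fix c
    obtain s where s: "c \<le> w m i s" using w_large by blast
    have "ereal c \<le> ord (X t m $ i - X u m $ i)" if "s \<le> t" "s \<le> u" for t u
    proof -
      have "ereal c \<le> ord (X t m $ i - X s m $ i)" "ereal c \<le> ord (X u m $ i - X s m $ i)"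
        using s ord_diff that by (meson ereal_less_eq(3) order_trans)+
      then have "ereal c \<le> ord ((X t m $ i - X s m $ i) - (X u m $ i - X s m $ i))"
        by (rule ord_ge_diff)
      then show ?thesis by simp
    qed
    then show "\<exists>N. \<forall>t\<ge>N. \<forall>u\<ge>N. ereal c \<le> ord (X t m $ i - X u m $ i)" by blast
  qed
  then obtain y where y: "\<And>m i. ord_converges (\<lambda>t. X t m $ i) (y m i)" by metis
  define Y where "Y = (\<lambda>m. Abs_fps (y m))"
  have ord_Y: "ereal (w m i s) \<le> ord (Y m $ i - X s m $ i)" for m i s
  proof -
    obtain N where N: "\<And>t. N \<le> t \<Longrightarrow> ereal (w m i s) \<le> ord (X t m $ i - y m i)"
      using y[of m i] unfolding ord_converges_def by blast
    \<comment> \<open>An index late enough both for the limit estimate and for comparison with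
      \<open>X s\<close>.\<close>
    define t where "t = max N s"
    have "ereal (w m i s) \<le> ord ((X t m $ i - X s m $ i) - (X t m $ i - y m i))"
      by (intro ord_ge_diff N ord_diff) (simp_all add: t_def)
    then show ?thesis by (simp add: Y_def)
  qed
  have "Y m = 0" if "m \<notin> {1..k+1}" for m
  proof (rule fps_ext)
    fix i
    have "X s m = 0" for s using row[of s] that by (auto simp: row_vectors_def)
    then have "ereal (b / 3 * real (2 * i + m) + \<rho> + real s * \<epsilon>) \<le> ord (Y m $ i)" for s
      using ord_Y[of m i s] by (simp add: w_def add.assoc)
    then have "Y m $ i = 0" by (rule eq_0_if_ord_unbounded[OF _ \<epsilon>_pos])
    then show "Y m $ i = 0 $ i" by simp
  qed
  then have "Y \<in> row_vectors k" by (auto simp: row_vectors_def)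
  then have "Y - X t \<in> M_rho ord k b (\<rho> + real t * \<epsilon>)" for t
    using ord_Y row_vectors_diff[OF _ row] by (simp add: M_rho_iff growth_def w_def)
  then show ?thesis using that by blast
qed

text \<open>A fixed point \<open>Y = N (\<xi> + theta Y)\<close> gives the decomposition with \<eta>
  equal to \<open>- Y\<close>.\<close>

lemma M_sp_decomposition:
  assumes \<xi>: "\<xi> \<in> M_sp ord k b"
  shows "\<exists>v\<in>V_sp ord k b. \<exists>\<eta>\<in>M_tilde ord k b. \<exists>h\<in>L ord b. \<xi> = v + partial_a k \<pi> \<eta> + ker_mult k h"
proof -
  obtain \<rho> where \<rho>: "\<xi> \<in> M_rho ord k b \<rho>" using \<xi> by (auto simp: M_sp_def)
  then have row: "\<xi> \<in> row_vectors k" by (simp add: M_rho_iff)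
  let ?G = "\<lambda>\<eta>. row_times_mat k \<eta> (G_mat k \<pi>)"
  obtain N V H where N: "\<zeta> \<in> row_vectors k \<Longrightarrow> V \<zeta> \<in> V_span k \<and> N \<zeta> \<in> row_vectors k \<and> N \<zeta> (k + 1) = 0 \<and>
      \<zeta> = V \<zeta> + ?G (N \<zeta>) + ker_mult k (H \<zeta>) \<and>
      (\<forall>\<rho>. \<zeta> \<in> M_rho ord k b \<rho> \<longrightarrow> N \<zeta> \<in> M_rho ord k b (\<rho> + \<epsilon>) \<and> H \<zeta> \<in> L ord b)" for \<zeta>
    using decomposition_exists by metis
  \<comment> \<open>\<open>N\<close> is only a choice function; uniqueness of the decomposition
    makes it additive.\<close>
  have N_diff: "N \<zeta> - N \<zeta>' = N (\<zeta> - \<zeta>')" if \<zeta>: "\<zeta> \<in> row_vectors k" "\<zeta>' \<in> row_vectors k" for \<zeta> \<zeta>'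
  proof -
    note N1 = N[OF \<zeta>(1)] and N2 = N[OF \<zeta>(2)] and N3 = N[OF row_vectors_diff[OF \<zeta>]]
    let ?v = "V \<zeta> - V \<zeta>' - V (\<zeta> - \<zeta>')" and ?\<eta> = "N \<zeta> - N \<zeta>' - N (\<zeta> - \<zeta>')"
    let ?h = "H \<zeta> - H \<zeta>' - H (\<zeta> - \<zeta>')"
    have "?v \<in> V_span k" using N1 N2 N3 unfolding V_span_def by (intro row.span_diff) auto
    moreover have "?\<eta> \<in> row_vectors k" "?\<eta> (k + 1) = 0" using N1 N2 N3 by (auto intro: row_vectors_diff)
    moreover have "?v + ?G ?\<eta> + ker_mult k ?h = (V \<zeta> + ?G (N \<zeta>) + ker_mult k (H \<zeta>))
        - (V \<zeta>' + ?G (N \<zeta>') + ker_mult k (H \<zeta>'))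
        - (V (\<zeta> - \<zeta>') + ?G (N (\<zeta> - \<zeta>')) + ker_mult k (H (\<zeta> - \<zeta>')))"
      unfolding row_times_mat_diff ker_mult_diff by (simp add: algebra_simps)
    then have "?v + ?G ?\<eta> + ker_mult k ?h = 0" using N1 N2 N3 by simp
    ultimately have "?\<eta> = 0" by (rule decomposition_unique(2))
    then show ?thesis by simp
  qed
  \<comment> \<open>Picard iteration towards the fixed point.\<close>
  define X where "X = rec_nat 0 (\<lambda>_ x. N (\<xi> + theta x))"
  have X: "X 0 = 0" "\<And>t. X (Suc t) = N (\<xi> + theta (X t))" by (simp_all add: X_def)
  have X_row: "X t \<in> row_vectors k" for t
    by (induction t) (auto simp: X N row row_vectors_add theta_in_row_vectors, simp add: row_vectors_def)
  \<comment> \<open>The contraction estimate: \<open>theta\<close> keeps the level and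
    \<open>N\<close> raises it by \<epsilon>.\<close>
  have N_theta_diff: "N (\<xi> + theta x) - N (\<xi> + theta y) \<in> M_rho ord k b (\<sigma> + \<epsilon>)"
    if "x \<in> row_vectors k" "y \<in> row_vectors k" "x - y \<in> M_rho ord k b \<sigma>" for x y \<sigma>
  proof -
    have "(\<xi> + theta x) - (\<xi> + theta y) = theta (x - y)" by (simp add: theta_diff)
    then have "N (\<xi> + theta x) - N (\<xi> + theta y) = N (theta (x - y))"
      using that by (simp add: N_diff row row_vectors_add theta_in_row_vectors)
    then show ?thesis
      using N M_rho_theta[OF that(3)] by (simp add: that row_vectors_diff theta_in_row_vectors)
  qed
  have X_step: "X (Suc t) - X t \<in> M_rho ord k b (\<rho> + real t * \<epsilon>)" for t
  proof (induction t)
    case 0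
    have "theta 0 = (0 :: nat \<Rightarrow> 'a fps)" by (simp add: theta_def fun_eq_iff)
    then have "X 1 \<in> M_rho ord k b (\<rho> + \<epsilon>)" using N[OF row] \<rho> by (simp add: X)
    then show ?case using M_rho_mono[of _ "\<rho> + \<epsilon>" \<rho>] \<epsilon>_pos by (simp add: X)
  next
    case (Suc t)
    have "\<rho> + real t * \<epsilon> + \<epsilon> = \<rho> + real (Suc t) * \<epsilon>" by (simp add: algebra_simps)
    then show ?case using N_theta_diff[OF X_row X_row Suc] unfolding X(2)[symmetric] by (rule subst)
  qed
  obtain Y where Y: "\<And>t. Y - X t \<in> M_rho ord k b (\<rho> + real t * \<epsilon>)"
    using M_rho_limit[OF X_row X_step] by blast
  have Y_M: "Y \<in> M_rho ord k b \<rho>" using Y[of 0] by (simp add: X)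
  then have Y_row: "Y \<in> row_vectors k" by (simp add: M_rho_iff)
  let ?\<zeta> = "\<xi> + theta Y"
  have \<zeta>_row: "?\<zeta> \<in> row_vectors k" by (intro row_vectors_add row theta_in_row_vectors Y_row)
  \<comment> \<open>Both \<open>Y\<close> and its image are close to \<open>X (Suc t)\<close> for
    every \<open>t\<close>, so they agree.\<close>
  have "Y - N ?\<zeta> = 0"
  proof (rule M_rho_all_0)
    fix t
    have "N (\<xi> + theta Y) - N (\<xi> + theta (X t)) \<in> M_rho ord k b (\<rho> + real t * \<epsilon> + \<epsilon>)"
      by (rule N_theta_diff[OF Y_row X_row Y])
    moreover have "Y - X (Suc t) \<in> M_rho ord k b (\<rho> + real t * \<epsilon> + \<epsilon>)"
      using Y[of "Suc t"] by (simp add: algebra_simps)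
    ultimately have "(Y - X (Suc t)) - (N ?\<zeta> - N (\<xi> + theta (X t))) \<in> M_rho ord k b (\<rho> + real t * \<epsilon> + \<epsilon>)"
      by (rule M_rho_diff[rotated])
    then have "Y - N ?\<zeta> \<in> M_rho ord k b (\<rho> + real t * \<epsilon> + \<epsilon>)"
      by (simp add: X)
    then show "Y - N ?\<zeta> \<in> M_rho ord k b (\<rho> + real t * \<epsilon>)"
      by (rule M_rho_mono) (use \<epsilon>_pos in simp)
  qed
  then have NY: "N ?\<zeta> = Y" by simp
  have Y_sp: "0 - Y \<in> M_sp ord k b"
    using Y_M row.subspace_diff[OF subspace_M_sp row.subspace_0[OF subspace_M_sp]] by (auto simp: M_sp_def)
  moreover have "Y (k + 1) = 0" using N[OF \<zeta>_row] NY by metis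
  ultimately have \<eta>: "0 - Y \<in> M_tilde ord k b" by (simp add: M_tilde_def)
  have "?\<zeta> \<in> M_rho ord k b \<rho>" by (intro M_rho_add \<rho> M_rho_theta Y_M)
  then have h: "H ?\<zeta> \<in> L ord b" and v: "V ?\<zeta> \<in> V_span k" using N[OF \<zeta>_row] by auto
  have D: "?\<zeta> = V ?\<zeta> + ?G Y + ker_mult k (H ?\<zeta>)" using N[OF \<zeta>_row] unfolding NY by blast
  \<comment> \<open>The sign of \<open>- Y\<close> compensates for G entering
    \<open>partial_a\<close> negatively.\<close>
  have P: "partial_a k \<pi> (0 - Y) = ?G Y - theta Y"
    unfolding partial_a_eq theta_diff row_times_mat_diff
    by (simp add: fun_eq_iff theta_def row_times_mat_def)
  have E: "x = a + (g - t) + c" if "x + t = a + g + c" for x t a g c :: "nat \<Rightarrow> 'a fps"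
    using arg_cong[OF that, of "\<lambda>u. u - t"] by (simp add: algebra_simps)
  have eq: "\<xi> = V ?\<zeta> + partial_a k \<pi> (0 - Y) + ker_mult k (H ?\<zeta>)"
    unfolding P by (rule E[OF D])
  \<comment> \<open>The growth of the V_k component is inherited from the other terms.\<close>
  then have "V ?\<zeta> = \<xi> - partial_a k \<pi> (0 - Y) - ker_mult k (H ?\<zeta>)" by (simp add: algebra_simps)
  also have "\<dots> \<in> M_sp ord k b"
    by (intro row.subspace_diff[OF subspace_M_sp] \<xi> partial_a_M_sp[OF Y_sp] ker_mult_M_sp[OF h])
  finally have "V ?\<zeta> \<in> V_sp ord k b" using v by (simp add: V_sp_def)
  then show ?thesis using eq \<eta> h by blast
qed

text \<open>Inserting the algebraic decomposition of \<open>theta \<eta>\<close> turns the relation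
  into one covered by \<open>decomposition_unique\<close>. It identifies \<eta> with the \<eta>' of
  that decomposition, which lies one \<epsilon> higher; repetition leaves only zero.\<close>

lemma sum_direct:
  assumes v: "v \<in> V_span k" and \<eta>: "\<eta> \<in> M_tilde ord k b"
    and eq: "v + partial_a k \<pi> \<eta> + ker_mult k h = 0"
  shows "v = 0" "\<eta> = 0" "h = 0"
proof -
  let ?G = "\<lambda>\<eta>. row_times_mat k \<eta> (G_mat k \<pi>)"
  obtain \<rho> where \<rho>: "\<eta> \<in> M_rho ord k b \<rho>" and last: "\<eta> (k + 1) = 0"
    using \<eta> by (auto simp: M_tilde_def M_sp_def)
  have row: "\<eta> \<in> row_vectors k" using \<rho> by (simp add: M_rho_iff)
  have improve: "\<eta> \<in> M_rho ord k b (\<sigma> + \<epsilon>)" if \<sigma>: "\<eta> \<in> M_rho ord k b \<sigma>" for \<sigma>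
  proof -
    obtain v' \<eta>' h' where d: "v' \<in> V_span k" "\<eta>' \<in> row_vectors k" "\<eta>' (k + 1) = 0"
      "theta \<eta> = v' + ?G \<eta>' + ker_mult k h'" "\<eta>' \<in> M_rho ord k b (\<sigma> + \<epsilon>)"
      using decomposition_exists[OF theta_in_row_vectors[OF row]] M_rho_theta[OF \<sigma>] by blast
    have "v + v' \<in> V_span k" using v d(1) unfolding V_span_def by (rule row.span_add)
    moreover have "\<eta>' - \<eta> \<in> row_vectors k" "(\<eta>' - \<eta>) (k + 1) = 0"
      using d row last by (auto intro: row_vectors_diff)
    moreover have "(v + v') + ?G (\<eta>' - \<eta>) + ker_mult k (h + h')
        = v + ((v' + ?G \<eta>' + ker_mult k h') - ?G \<eta>) + ker_mult k h"
      unfolding row_times_mat_diff ker_mult_add by (simp add: algebra_simps)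
    then have "(v + v') + ?G (\<eta>' - \<eta>) + ker_mult k (h + h') = 0"
      using eq unfolding partial_a_eq d(4) by simp
    ultimately have "\<eta>' - \<eta> = 0" by (rule decomposition_unique(2))
    then show ?thesis using d(5) by simp
  qed
  have "\<eta> \<in> M_rho ord k b (\<rho> + real t * \<epsilon>)" for t
  proof (induction t)
    case (Suc t)
    from improve[OF this] show ?case by (simp add: algebra_simps)
  qed (use \<rho> in simp)
  then show \<eta>0: "\<eta> = 0" by (rule M_rho_all_0)
  have "partial_a k \<pi> \<eta> = - row_times_mat k \<eta> (G_mat k \<pi>)"
    unfolding \<eta>0 by (simp add: partial_a_eq fun_eq_iff theta_def)
  moreover have "row_times_mat k \<eta> (G_mat k \<pi>) = 0"
    unfolding \<eta>0 by (simp add: fun_eq_iff row_times_mat_def)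
  ultimately have "v + row_times_mat k \<eta> (G_mat k \<pi>) + ker_mult k h = 0" using eq by simp
  from decomposition_unique[OF v row last this] show "v = 0" "h = 0" by auto
qed

section \<open>The summands as subspaces, and assembly of the direct sum\<close>

lemma subspace_V_sp: "row.subspace (V_sp ord k b)"
  unfolding V_sp_def V_span_def by (intro row.subspace_inter row.subspace_span subspace_M_sp)

lemma subspace_partial_a: "row.subspace (partial_a k \<pi> ` M_tilde ord k b)"
proof (rule row.subspaceI)
  note M = subspace_M_sp
  have "0 \<in> M_tilde ord k b" using row.subspace_0[OF M] by (simp add: M_tilde_def)
  moreover have "partial_a k \<pi> 0 = 0"
    by (simp add: partial_a_def row_times_mat_def fun_eq_iff)
  ultimately show "0 \<in> partial_a k \<pi> ` M_tilde ord k b" by force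
  fix x assume "x \<in> partial_a k \<pi> ` M_tilde ord k b"
  then obtain \<xi> where x: "x = partial_a k \<pi> \<xi>" and \<xi>: "\<xi> \<in> M_tilde ord k b" by blast
  {
    fix y assume "y \<in> partial_a k \<pi> ` M_tilde ord k b"
    then obtain \<eta> where y: "y = partial_a k \<pi> \<eta>" and \<eta>: "\<eta> \<in> M_tilde ord k b" by blast
    have "\<xi> + \<eta> \<in> M_tilde ord k b"
      using \<xi> \<eta> row.subspace_add[OF M] by (simp add: M_tilde_def)
    moreover have "x + y = partial_a k \<pi> (\<xi> + \<eta>)"
      unfolding x y partial_a_eq theta_add row_times_mat_add by (simp add: algebra_simps)
    ultimately show "x + y \<in> partial_a k \<pi> ` M_tilde ord k b" by blast
  }
  fix c
  have "scale_row c \<xi> \<in> M_tilde ord k b"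
    using \<xi> row.subspace_scale[OF M] by (simp add: M_tilde_def scale_row_def)
  moreover have "scale_row c x = partial_a k \<pi> (scale_row c \<xi>)"
    unfolding x partial_a_eq theta_scale row_times_mat_scale by (rule row.scale_right_diff_distrib)
  ultimately show "scale_row c x \<in> partial_a k \<pi> ` M_tilde ord k b" by blast
qed

lemma subspace_I_ker: "row.subspace (I_ker ord k b)"
  unfolding I_ker_eq
proof (rule row.subspaceI)
  have "0 \<in> L_rho ord b 0" by (simp add: L_rho_def)
  then have "0 \<in> L ord b" unfolding L_def by blast
  then show "0 \<in> ker_mult k ` L ord b" using ker_mult_0 by (metis imageI)
  fix x assume "x \<in> ker_mult k ` L ord b"
  then obtain f \<rho> where x: "x = ker_mult k f" and f: "f \<in> L_rho ord b \<rho>" by (auto simp: L_def)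
  {
    fix y assume "y \<in> ker_mult k ` L ord b"
    then obtain g \<sigma> where y: "y = ker_mult k g" and g: "g \<in> L_rho ord b \<sigma>" by (auto simp: L_def)
    have mono: "ereal (2 * b / 3 * real i + min \<rho> \<sigma>) \<le> ereal (2 * b / 3 * real i + \<rho>)"
      "ereal (2 * b / 3 * real i + min \<rho> \<sigma>) \<le> ereal (2 * b / 3 * real i + \<sigma>)" for i by simp_all
    have "f + g \<in> L_rho ord b (min \<rho> \<sigma>)"
      using f g mono unfolding L_rho_def mem_Collect_eq fps_add_nth by (meson ord_ge_add order_trans)
    then show "x + y \<in> ker_mult k ` L ord b"
      unfolding x y ker_mult_add[symmetric] L_def by blast
  }
  fix c
  obtain r where r: "ereal r \<le> ord c"
    using ord_real[of c] by (metis ereal_less_eq(1) ord_0 order_refl)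
  have "fps_const c * f \<in> L_rho ord b (r + \<rho>)"
    using f r unfolding L_rho_def by (auto intro: ord_ge_mult)
  moreover have "scale_row c x = ker_mult k (fps_const c * f)"
    by (simp add: x scale_row_def ker_mult_def fun_eq_iff algebra_simps)
  ultimately show "scale_row c x \<in> ker_mult k ` L ord b" unfolding L_def by blast
qed

lemma direct_sum:
  "is_direct_sum3 (M_sp ord k b) (V_sp ord k b) (partial_a k \<pi> ` M_tilde ord k b) (I_ker ord k b)"
proof -
  have "V_sp ord k b + partial_a k \<pi> ` M_tilde ord k b + I_ker ord k b \<subseteq> M_sp ord k b"
  proof
    fix x assume "x \<in> V_sp ord k b + partial_a k \<pi> ` M_tilde ord k b + I_ker ord k b"
    then obtain v \<eta> h where "x = v + partial_a k \<pi> \<eta> + ker_mult k h"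
      "v \<in> V_sp ord k b" "\<eta> \<in> M_tilde ord k b" "h \<in> L ord b"
      unfolding I_ker_eq by (auto elim!: set_plus_elim)
    then show "x \<in> M_sp ord k b"
      by (auto intro!: row.subspace_add[OF subspace_M_sp] partial_a_M_sp ker_mult_M_sp
          simp: V_sp_def M_tilde_def)
  qed
  moreover have "M_sp ord k b \<subseteq> V_sp ord k b + partial_a k \<pi> ` M_tilde ord k b + I_ker ord k b"
    unfolding I_ker_eq using M_sp_decomposition by (blast intro: set_plus_intro)
  moreover have "x = 0 \<and> y = 0 \<and> z = 0"
    if xyz: "x \<in> V_sp ord k b" "y \<in> partial_a k \<pi> ` M_tilde ord k b" "z \<in> I_ker ord k b"
      "x + y + z = 0" for x y z
  proof -
    obtain \<eta> where \<eta>: "y = partial_a k \<pi> \<eta>" "\<eta> \<in> M_tilde ord k b" using xyz(2) by blast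
    obtain h where h: "z = ker_mult k h" using xyz(3) unfolding I_ker_eq by blast
    have "x \<in> V_span k" using xyz by (simp add: V_sp_def)
    \<comment> \<open>With \<open>x\<close> and \<open>h\<close> gone, the relation itself makes
      \<open>y\<close> vanish.\<close>
    from sum_direct[OF this \<eta>(2), of h] have "x = 0" "h = 0"
      using xyz(4) unfolding \<eta>(1) h by auto
    then show ?thesis using xyz(4) h ker_mult_0 by auto
  qed
  ultimately show ?thesis
    unfolding is_direct_sum3_def
    using subspace_M_sp subspace_V_sp subspace_partial_a subspace_I_ker by blast
qed

end

theorem theorem6p11:
  fixes p k :: nat
    and b :: real
    and ord :: "'a::{field_char_0, alg_closed_field} \<Rightarrow> ereal"
    and \<pi> :: 'a
  assumes "prime p" and "p \<ge> 5"
    and "padic_complex_field p ord"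
    and "\<pi> ^ (p - 1) = - of_nat p"
    and "even k" and "k < p"
    and "b - 1 / (real p - 1) > 0"
  shows "is_direct_sum3 (M_sp ord k b)
           (V_sp ord k b) (partial_a k \<pi> ` M_tilde ord k b) (I_ker ord k b)"
proof -
  obtain n where n: "k = 2 * n" using assms(5) by blast
  interpret padic_complex_field p ord by (rule assms(3))
  interpret dwork_setting p ord k n b \<pi>
    by unfold_locales (use assms n in auto)
  show ?thesis by (rule direct_sum)
qed

end
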